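(* Let $G$ be the cubic graph constructed below. Then $\rho(G)=12$, $\omega_{\mathrm w}(G)=14$, and $\omega(G)=16$.
   Context: An \emph{even factor} of a graph is a spanning subgraph in which every vertex has even degree; a component is \emph{odd} if it has an odd number of vertices. The \emph{weak oddness} $\omega_{\mathrm w}(G)$ of a cubic graph is the least number of odd components in an even factor; the \emph{oddness} $\omega(G)$ of a bridgeless cubic graph is the minimum number of odd circuits in a $2$-factor; the \emph{resistance} $\rho(G)$ is the minimum number of vertices whose deletion leaves a graph with a proper $3$-edge-colouring. A \emph{$2$-pole} $(K,s,t)$ is a graph $K$ with two distinct vertices $s,t$ of degree one (terminals); the edges at them are terminal edges. Joining terminal edges of two disjoint $2$-poles means identifying the two terminal vertices and suppressing the resulting degree-$2$ vertex. Construction: Let $P$ be the $2$-pole obtained from the Petersen graph by subdividing one edge $uv$ with a new vertex $w$ and then splitting off $w$ (delete $w$ and attach a new degree-one terminal vertex to each of the two dangling edges). The $2$-pole $H$: take two copies $(P_1,s_1,t_1)$, $(P_2,s_2,t_2)$ of $P$, identify $s_1$ with $s_2$ and $t_1$ with $t_2$, and attach a new terminal edge (to a new degree-one vertex) at each of the two identified vertices; these two new degree-one vertices are the terminals of $H$. The $2$-pole $H_2$: take two copies of $H$ and join a terminal edge of the first to a terminal edge of the second; the two remaining terminals are the terminals of $H_2$. The graph $G$: take $K_4$ on $u_0,u_1,u_2,u_3$ and delete all edges incident with $u_0$; then for each $i\in\{1,2,3\}$ take a new copy of $H_2$ and identify one of its terminals with $u_0$ and the other with $u_i$. *)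

theory Defs
  imports Main
begin

text \<open>
  Simple graphs: edges are two-element subsets of the vertex set. None of the graphs
  constructed below has loops or parallel edges, also in the intermediate steps.
\<close>

record 'a graph =
  verts :: "'a set"
  edges :: "'a set set"

definition degree :: "'a graph \<Rightarrow> 'a \<Rightarrow> nat" where
  "degree G v = card {e \<in> edges G. v \<in> e}"

definition neighbours :: "'a graph \<Rightarrow> 'a \<Rightarrow> 'a set" where
  "neighbours G v = {x. {v, x} \<in> edges G}"

definition components :: "'a graph \<Rightarrow> 'a set set" where
  "components G = verts G // {(x, y). {x, y} \<in> edges G}\<^sup>*"

definition odd_components :: "'a graph \<Rightarrow> 'a set set" where
  "odd_components G = {C \<in> components G. odd (card C)}"

definition spanning_subgraph :: "'a graph \<Rightarrow> 'a graph \<Rightarrow> bool" where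
  "spanning_subgraph F G \<longleftrightarrow> verts F = verts G \<and> edges F \<subseteq> edges G"

definition even_factor :: "'a graph \<Rightarrow> 'a graph \<Rightarrow> bool" where
  "even_factor F G \<longleftrightarrow> spanning_subgraph F G \<and> (\<forall>v \<in> verts G. even (degree F v))"

definition two_factor :: "'a graph \<Rightarrow> 'a graph \<Rightarrow> bool" where
  "two_factor F G \<longleftrightarrow> spanning_subgraph F G \<and> (\<forall>v \<in> verts G. degree F v = 2)"

definition weak_oddness :: "'a graph \<Rightarrow> nat" where
  "weak_oddness G = (LEAST k. \<exists>F. even_factor F G \<and> card (odd_components F) = k)"

text \<open>
  The components of a two-factor are its circuits, and the length of a circuit is its
  number of vertices, so the odd circuits of a two-factor are its odd components.
\<close>

definition oddness :: "'a graph \<Rightarrow> nat" where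
  "oddness G = (LEAST k. \<exists>F. two_factor F G \<and> card (odd_components F) = k)"

definition delete_verts :: "'a set \<Rightarrow> 'a graph \<Rightarrow> 'a graph" where
  "delete_verts S G = \<lparr>verts = verts G - S, edges = {e \<in> edges G. e \<inter> S = {}}\<rparr>"

definition proper_edge_colouring :: "nat \<Rightarrow> ('a set \<Rightarrow> nat) \<Rightarrow> 'a graph \<Rightarrow> bool" where
  "proper_edge_colouring k c G \<longleftrightarrow>
     (\<forall>e \<in> edges G. c e < k) \<and>
     (\<forall>e \<in> edges G. \<forall>f \<in> edges G. e \<noteq> f \<and> e \<inter> f \<noteq> {} \<longrightarrow> c e \<noteq> c f)"

definition resistance :: "'a graph \<Rightarrow> nat" where
  "resistance G = (LEAST k. \<exists>S. S \<subseteq> verts G \<and> card S = k \<and>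
     (\<exists>c. proper_edge_colouring 3 c (delete_verts S G)))"


definition map_graph :: "('a \<Rightarrow> 'b) \<Rightarrow> 'a graph \<Rightarrow> 'b graph" where
  "map_graph f G = \<lparr>verts = f ` verts G, edges = (\<lambda>e. f ` e) ` edges G\<rparr>"

definition disjoint_union :: "'a graph \<Rightarrow> 'b graph \<Rightarrow> ('a + 'b) graph" where
  "disjoint_union G H =
     \<lparr>verts = verts (map_graph Inl G) \<union> verts (map_graph Inr H),
      edges = edges (map_graph Inl G) \<union> edges (map_graph Inr H)\<rparr>"

definition copies :: "'i set \<Rightarrow> 'a graph \<Rightarrow> ('i \<times> 'a) graph" where
  "copies I G =
     \<lparr>verts = (\<Union>i \<in> I. verts (map_graph (Pair i) G)),
      edges = (\<Union>i \<in> I. edges (map_graph (Pair i) G))\<rparr>"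

text \<open>The vertex \<open>y\<close> is merged into \<open>x\<close>.\<close>

definition identify :: "'a \<Rightarrow> 'a \<Rightarrow> 'a graph \<Rightarrow> 'a graph" where
  "identify x y G = map_graph (id(y := x)) G"

definition add_pendant :: "'a \<Rightarrow> 'a \<Rightarrow> 'a graph \<Rightarrow> 'a graph" where
  "add_pendant x z G = \<lparr>verts = insert z (verts G), edges = insert {x, z} (edges G)\<rparr>"

definition subdivide :: "'a \<Rightarrow> 'a \<Rightarrow> 'a \<Rightarrow> 'a graph \<Rightarrow> 'a graph" where
  "subdivide u v w G =
     \<lparr>verts = insert w (verts G), edges = edges G - {{u, v}} \<union> {{u, w}, {w, v}}\<rparr>"

text \<open>
  For a vertex \<open>w\<close> of degree two with neighbours \<open>u\<close> and \<open>v\<close>: the dangling edges left by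
  the deletion of \<open>w\<close> receive the new end-vertices \<open>s\<close> (at \<open>u\<close>) and \<open>t\<close> (at \<open>v\<close>).
\<close>

definition split_off :: "'a \<Rightarrow> 'a \<Rightarrow> 'a \<Rightarrow> 'a \<Rightarrow> 'a \<Rightarrow> 'a graph \<Rightarrow> 'a graph" where
  "split_off w u v s t G = add_pendant v t (add_pendant u s (delete_verts {w} G))"

text \<open>For a vertex \<open>x\<close> of degree two, its neighbourhood is the new edge.\<close>

definition suppress :: "'a \<Rightarrow> 'a graph \<Rightarrow> 'a graph" where
  "suppress x G =
     \<lparr>verts = verts G - {x}, edges = insert (neighbours G x) (edges (delete_verts {x} G))\<rparr>"


type_synonym 'a two_pole = "'a graph \<times> 'a \<times> 'a"

text \<open>
  The outer cycle is 0, 1, 2, 3, 4 and the inner pentagram is on 5, 6, 7, 8, 9. The Petersen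
  graph is arc-transitive, so it does not matter which edge is used to obtain the 2-pole,
  nor which of its terminals comes first.
\<close>

definition petersen :: "nat graph" where
  "petersen =
     \<lparr>verts = {0..<10},
      edges = (\<Union>i \<in> {0..<5}. {{i, (i + 1) mod 5}, {i, 5 + i}, {5 + i, 5 + (i + 2) mod 5}})\<rparr>"

definition pole_P :: "nat two_pole" where
  "pole_P = (split_off 10 0 1 11 12 (subdivide 0 1 10 petersen), 11, 12)"

definition parallel_pole :: "'a two_pole \<Rightarrow> ((nat \<times> 'a) + bool) two_pole" where
  "parallel_pole = (\<lambda>(K, s, t).
     let D = identify (1, t) (2, t) (identify (1, s) (2, s) (copies {1, 2} K))
     in (add_pendant (Inl (1, t)) (Inr True)
           (add_pendant (Inl (1, s)) (Inr False) (map_graph Inl D)),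
         Inr False, Inr True))"

definition pole_H :: "((nat \<times> nat) + bool) two_pole" where
  "pole_H = parallel_pole pole_P"

definition join_two :: "'a two_pole \<Rightarrow> (nat \<times> 'a) two_pole" where
  "join_two = (\<lambda>(K, s, t).
     (suppress (1, t) (identify (1, t) (2, s) (copies {1, 2} K)), (1, s), (2, t)))"

definition pole_H2 :: "(nat \<times> ((nat \<times> nat) + bool)) two_pole" where
  "pole_H2 = join_two pole_H"

definition K4 :: "nat graph" where
  "K4 = \<lparr>verts = {0, 1, 2, 3}, edges = {e. e \<subseteq> {0, 1, 2, 3} \<and> card e = 2}\<rparr>"

definition K4_cut :: "nat graph" where
  "K4_cut = \<lparr>verts = verts K4, edges = {e \<in> edges K4. 0 \<notin> e}\<rparr>"

text \<open>
  In the \<open>i\<close>-th copy of the 2-pole the first terminal is identified with the vertex \<open>0\<close> and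
  the second one with the vertex \<open>i\<close> of the complete graph.
\<close>

definition attach_to_K4 :: "'a two_pole \<Rightarrow> (nat + (nat \<times> 'a)) graph" where
  "attach_to_K4 = (\<lambda>(K, s, t).
     fold (\<lambda>i. identify (Inl i) (Inr (i, t)) \<circ> identify (Inl 0) (Inr (i, s))) [1, 2, 3]
       (disjoint_union K4_cut (copies {1, 2, 3} K)))"

definition graph_G :: "(nat + (nat \<times> (nat \<times> ((nat \<times> nat) + bool)))) graph" where
  "graph_G = attach_to_K4 pole_H2"

end

theory Submission
  imports Defs "HOL-Library.Disjoint_Sets"
begin

text \<open>
  Besides the four vertices of the complete graph and the twelve vertices produced by the parallel
  constructions, the graph consists of twelve copies of the Petersen graph minus an edge.

  Resistance: a copy of the Petersen graph minus an edge is not 3-edge-colourable, so each of the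
  twelve copies contains a deleted vertex; deleting one suitable vertex from each copy suffices.

  Oddness: an even factor enters a copy through both terminal edges or through none. If it passes
  through, the copy contains at least one odd component, because the Petersen graph has no even
  factor without odd components; otherwise it contains at least two, since it has ten vertices.
  A copy of \<open>H\<close> thus contains at least three odd components when it is traversed and at least two
  otherwise, so the three copies of \<open>H\<^sub>2\<close> together contain at least 12 odd components, plus two for
  each traversed copy of \<open>H\<^sub>2\<close>. A 2-factor traverses exactly two of them; an even factor may also
  leave \<open>u\<^sub>0\<close> isolated and traverse none, and then both \<open>u\<^sub>0\<close> and the triangle \<open>u\<^sub>1u\<^sub>2u\<^sub>3\<close>
  contribute a further odd component.
\<close>

section \<open>Vertices and edges of the graph\<close>

lemma map_graph_comp: "map_graph f (map_graph g G) = map_graph (f \<circ> g) G"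
  by (simp add: map_graph_def image_image image_comp comp_def)

lemma map_graph_copies:
  "verts (map_graph f (copies I G)) = (\<Union>i\<in>I. (\<lambda>v. f (i, v)) ` verts G)"
  "edges (map_graph f (copies I G)) = (\<Union>i\<in>I. (`) (\<lambda>v. f (i, v)) ` edges G)"
  unfolding map_graph_def copies_def by (simp_all add: image_UN image_image)

lemma edges_delete_vert: "edges (delete_verts {x} G) = edges G - {e. x \<in> e}"
  by (auto simp: delete_verts_def)

text \<open>Merging the terminals of the second copy into those of the first amounts to resetting
  the copy index of \<open>s\<close> and \<open>t\<close> to 1, so both identifications together are
  a single map on the copies.\<close>

lemma parallel_pole_graph:
  shows verts_parallel_pole: "verts (fst (parallel_pole (K, s, t))) =
     {Inr False, Inr True} \<union>
     (\<Union>p\<in>{1, 2}. (\<lambda>v. Inl (if v = s \<or> v = t then 1 else p, v)) ` verts K)"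
  and edges_parallel_pole: "edges (fst (parallel_pole (K, s, t))) =
     {{Inl (1, s), Inr False}, {Inl (1, t), Inr True}} \<union>
     (\<Union>p\<in>{1, 2}. (`) (\<lambda>v. Inl (if v = s \<or> v = t then 1 else p, v)) ` edges K)"
proof -
  define f :: "nat \<times> 'a \<Rightarrow> (nat \<times> 'a) + bool"
    where "f = Inl \<circ> (id((2, t) := (1, t)) \<circ> id((2, s) := (1, s)))"
  have f: "f (p, v) = Inl (if v = s \<or> v = t then 1 else p, v)" if "p \<in> {1, 2}" for p v
    using that by (auto simp: f_def)
  have "fst (parallel_pole (K, s, t)) = add_pendant (Inl (1, t)) (Inr True)
      (add_pendant (Inl (1, s)) (Inr False) (map_graph f (copies {1, 2} K)))"
    by (simp add: parallel_pole_def Let_def identify_def map_graph_comp f_def)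
  then show "verts (fst (parallel_pole (K, s, t))) =
     {Inr False, Inr True} \<union>
     (\<Union>p\<in>{1, 2}. (\<lambda>v. Inl (if v = s \<or> v = t then 1 else p, v)) ` verts K)"
   "edges (fst (parallel_pole (K, s, t))) =
     {{Inl (1, s), Inr False}, {Inl (1, t), Inr True}} \<union>
     (\<Union>p\<in>{1, 2}. (`) (\<lambda>v. Inl (if v = s \<or> v = t then 1 else p, v)) ` edges K)"
    by (simp_all add: add_pendant_def map_graph_copies f insert_commute)
qed

text \<open>With the terminal edges kept apart from \<open>E\<close>, the merged vertex meets
  exactly the second terminal edge of copy 1 and the first terminal edge of copy 2. Suppressing it
  therefore fuses these two into one edge and leaves \<open>E\<close> untouched.\<close>

lemma edges_join_two:
  assumes K: "edges K = {{a, s}, {b, t}} \<union> E" and E: "s \<notin> \<Union>E" "t \<notin> \<Union>E"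
    and st: "s \<noteq> t" "a \<notin> {s, t}" "b \<notin> {s, t}"
  shows "edges (fst (join_two (K, s, t))) =
     {{(1, a), (1, s)}, {(1, b), (2, a)}, {(2, b), (2, t)}} \<union> (\<Union>h\<in>{1, 2}. (`) (Pair h) ` E)"
proof -
  let ?J = "identify (1, t) (2, s) (copies {1::nat, 2} K)"
  define f :: "nat \<times> 'a \<Rightarrow> nat \<times> 'a" where "f = id((2, s) := (1, t))"
  have f: "f (h, v) = (if h = 2 \<and> v = s then (1, t) else (h, v))" for h v
    by (simp add: f_def)
  have "(\<lambda>v. f (h, v)) ` e = Pair h ` e" if "e \<in> E" for e and h
    by (rule image_cong) (use that E(1) in \<open>auto simp: f\<close>)
  then have "(`) (\<lambda>v. f (h, v)) ` E = (`) (Pair h) ` E" for h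
    by (rule image_cong[OF refl])
  then have J: "edges ?J = {{(1, a), (1, s)}, {(1, b), (1, t)}, {(2, a), (1, t)}, {(2, b), (2, t)}}
      \<union> (\<Union>h\<in>{1, 2}. (`) (Pair h) ` E)"
    unfolding identify_def map_graph_copies f_def[symmetric] K image_Un
    using st by (simp add: f insert_commute)
  have "neighbours ?J (1, t) = {(1, b), (2, a)}"
  proof -
    have "{(1, t), x} \<notin> (\<Union>h\<in>{1 :: nat, 2}. (`) (Pair h) ` E)" for x
    proof
      assume "{(1, t), x} \<in> (\<Union>h\<in>{1 :: nat, 2}. (`) (Pair h) ` E)"
      then obtain h e where "e \<in> E" "Pair h ` e = {(1, t), x}" by auto
      then have "(1, t) \<in> Pair h ` e" by simp
      with \<open>e \<in> E\<close> E(2) show False by auto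
    qed
    then have "neighbours ?J (1, t) =
        {x. {(1, t), x} \<in> {{(1, a), (1, s)}, {(1, b), (1, t)}, {(2, a), (1, t)}, {(2, b), (2, t)}}}"
      unfolding neighbours_def J by (simp only: Un_iff simp_thms)
    also have "\<dots> = {(1, b), (2, a)}"
      using st by (auto simp: doubleton_eq_iff)
    finally show ?thesis .
  qed
  moreover have "edges (delete_verts {(1, t)} ?J) =
      {{(1, a), (1, s)}, {(2, b), (2, t)}} \<union> (\<Union>h\<in>{1, 2}. (`) (Pair h) ` E)"
  proof -
    have "(\<Union>h\<in>{1 :: nat, 2}. (`) (Pair h) ` E) - {e. (1, t) \<in> e} = (\<Union>h\<in>{1, 2}. (`) (Pair h) ` E)"
      using E(2) by (intro Diff_triv) auto
    moreover have "t \<noteq> a" "t \<noteq> b" using st by auto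
    ultimately show ?thesis
      unfolding edges_delete_vert J Un_Diff using st by (simp add: insert_Diff_if)
  qed
  ultimately show ?thesis
    by (simp add: join_two_def suppress_def insert_commute)
qed

lemma verts_join_two:
  assumes "s \<noteq> t"
  shows "verts (fst (join_two (K, s, t))) = {1, 2} \<times> verts K - {(1, t), (2, s)}"
proof -
  have "verts (identify (1, t) (2, s) (copies {1 :: nat, 2} K)) - {(1, t)} =
      {1, 2} \<times> verts K - {(1, t), (2, s)}"
    unfolding identify_def map_graph_copies using assms by (auto split: if_splits)
  then show ?thesis
    by (simp add: join_two_def suppress_def)
qed

lemma edges_K4_cut: "edges K4_cut = {{1, 2}, {1, 3}, {2, 3}}"
proof
  show "edges K4_cut \<subseteq> {{1, 2}, {1, 3}, {2, 3}}"
    by (auto simp: K4_cut_def K4_def card_2_iff)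
qed (simp add: K4_cut_def K4_def)

context
  fixes K :: "'a graph" and s t :: 'a
  assumes st: "s \<noteq> t"
begin

text \<open>The composite of the six identifications that \<open>attach_to_K4\<close> performs one
  after the other.\<close>

private definition glue :: "nat + nat \<times> 'a \<Rightarrow> nat + nat \<times> 'a" where
  "glue = fold (\<lambda>i f. id(Inr (i, t) := Inl i) \<circ> (id(Inr (i, s) := Inl 0) \<circ> f)) [1, 2, 3] id"

private lemma glue_simps:
  "glue (Inl k) = Inl k"
  "i \<in> {1, 2, 3} \<Longrightarrow>
     glue (Inr (i, v)) = (if v = s then Inl 0 else if v = t then Inl i else Inr (i, v))"
  using st by (auto simp: glue_def)

private lemma attach_to_K4_glue:
  "attach_to_K4 (K, s, t) = map_graph glue (disjoint_union K4_cut (copies {1, 2, 3} K))"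
  by (simp add: attach_to_K4_def identify_def map_graph_comp glue_def comp_assoc)

lemma verts_attach_to_K4:
  assumes "s \<in> verts K" "t \<in> verts K"
  shows "verts (attach_to_K4 (K, s, t)) =
     Inl ` {0, 1, 2, 3} \<union> Inr ` ({1, 2, 3} \<times> (verts K - {s, t}))"
proof -
  have "verts (attach_to_K4 (K, s, t)) = (\<lambda>v. glue (Inl v)) ` {0, 1, 2, 3} \<union>
      (\<Union>i\<in>{1, 2, 3}. (\<lambda>v. glue (Inr (i, v))) ` verts K)"
    unfolding attach_to_K4_glue map_graph_def disjoint_union_def copies_def K4_cut_def K4_def
    by (simp add: image_Un image_image)
  also have "\<dots> = Inl ` {0, 1, 2, 3} \<union> Inr ` ({1, 2, 3} \<times> (verts K - {s, t}))"
    by (auto simp: glue_simps split: if_splits)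
  finally show ?thesis .
qed

lemma edges_attach_to_K4:
  assumes K: "edges K = {{a, s}, {b, t}} \<union> E" and E: "s \<notin> \<Union>E" "t \<notin> \<Union>E"
    and ab: "a \<notin> {s, t}" "b \<notin> {s, t}"
  shows "edges (attach_to_K4 (K, s, t)) =
     {{Inl 1, Inl 2}, {Inl 1, Inl 3}, {Inl 2, Inl 3}} \<union>
     (\<Union>i\<in>{1, 2, 3}. {{Inl 0, Inr (i, a)}, {Inl i, Inr (i, b)}} \<union>
       (`) (\<lambda>v. Inr (i, v)) ` E)"
proof -
  have "edges (attach_to_K4 (K, s, t)) = (`) (\<lambda>v. glue (Inl v)) ` edges K4_cut \<union>
      (\<Union>i\<in>{1, 2, 3}. (`) (\<lambda>v. glue (Inr (i, v))) ` edges K)"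
    unfolding attach_to_K4_glue map_graph_def disjoint_union_def copies_def
    by (simp add: image_Un image_image)
  moreover have "(`) (\<lambda>v. glue (Inr (i, v))) ` edges K =
      {{Inl 0, Inr (i, a)}, {Inl i, Inr (i, b)}} \<union> (`) (\<lambda>v. Inr (i, v)) ` E"
    if "i \<in> {1, 2, 3}" for i
  proof -
    have "(\<lambda>v. glue (Inr (i, v))) ` e = (\<lambda>v. Inr (i, v)) ` e" if "e \<in> E" for e
      by (rule image_cong) (use that E \<open>i \<in> _\<close> in \<open>auto simp: glue_simps\<close>)
    then have "(`) (\<lambda>v. glue (Inr (i, v))) ` E = (`) (\<lambda>v. Inr (i, v)) ` E"
      by (rule image_cong[OF refl])
    with that show ?thesis
      using ab st by (simp add: K image_Un glue_simps insert_commute)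
  qed
  ultimately show ?thesis
    by (simp add: edges_K4_cut glue_simps insert_commute)
qed

end

section \<open>Explicit edge sets of the poles and of the whole graph\<close>

lemma edges_petersen:
  "edges petersen = {{0, 1}, {1, 2}, {2, 3}, {3, 4}, {4, 0}, {0, 5}, {1, 6}, {2, 7}, {3, 8}, {4, 9},
     {5, 7}, {7, 9}, {9, 6}, {6, 8}, {8, 5}}"
proof -
  have "{0..<5} = {0, 1, 2, 3, 4 :: nat}" by auto
  then show ?thesis by (simp add: petersen_def insert_commute numeral_2_eq_2[symmetric])
qed

lemma pole_P_eq:
  "pole_P = (\<lparr>verts = insert 12 (insert 11 {0..<10}),
     edges = {{1, 12}, {0, 11}, {1, 2}, {2, 3}, {3, 4}, {0, 4}, {0, 5}, {1, 6}, {2, 7}, {3, 8},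
       {4, 9}, {5, 7}, {7, 9}, {6, 9}, {6, 8}, {5, 8}}\<rparr>, 11, 12)"
proof -
  have verts: "verts petersen = {0..<10}" by (simp add: petersen_def)
  have "edges (subdivide 0 1 10 petersen) = {{0, 10}, {1, 10}, {1, 2}, {2, 3}, {3, 4},
     {0, 4}, {0, 5}, {1, 6}, {2, 7}, {3, 8}, {4, 9}, {5, 7}, {7, 9}, {6, 9}, {6, 8}, {5, 8}}"
    unfolding subdivide_def edges_petersen
    by (simp add: insert_Diff_if doubleton_eq_iff) (simp add: insert_commute)
  then have "edges (delete_verts {10} (subdivide 0 1 10 petersen)) = {{1, 2}, {2, 3}, {3, 4},
     {0, 4}, {0, 5}, {1, 6}, {2, 7}, {3, 8}, {4, 9}, {5, 7}, {7, 9}, {6, 9}, {6, 8}, {5, 8}}"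
    by (simp add: edges_delete_vert insert_Diff_if)
  moreover have "verts (delete_verts {10} (subdivide 0 1 10 petersen)) = {0..<10}"
    by (auto simp: delete_verts_def subdivide_def verts)
  ultimately show ?thesis
    unfolding pole_P_def split_off_def add_pendant_def by simp
qed

type_synonym vertex = "nat + (nat \<times> (nat \<times> ((nat \<times> nat) + bool)))"

abbreviation pv :: "nat \<Rightarrow> nat \<Rightarrow> nat \<Rightarrow> nat \<Rightarrow> vertex" where
  "pv i h p v \<equiv> Inr (i, (h, Inl (p, v)))"

text \<open>
  \<open>emb i h p\<close> embeds the \<open>p\<close>-th copy of \<open>P\<close> in the \<open>h\<close>-th copy of \<open>H\<close> in the \<open>i\<close>-th copy of \<open>H\<^sub>2\<close>;
  the terminals 11 and 12 of both copies of \<open>P\<close> are merged into those of the first one.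
\<close>

definition emb :: "nat \<Rightarrow> nat \<Rightarrow> nat \<Rightarrow> nat \<Rightarrow> vertex" where
  "emb i h p v = (if v = 11 \<or> v = 12 then pv i h 1 v else pv i h p v)"

abbreviation "EP \<equiv> edges (fst pole_P)"

lemma edges_pole_P:
  "EP = {{1, 12}, {0, 11}, {1, 2}, {2, 3}, {3, 4}, {0, 4}, {0, 5}, {1, 6}, {2, 7}, {3, 8},
     {4, 9}, {5, 7}, {7, 9}, {6, 9}, {6, 8}, {5, 8}}"
  by (simp add: pole_P_eq)

lemma pole_P_expand: "pole_P = (fst pole_P, 11, 12)"
  by (simp add: pole_P_eq)

lemma pole_H_expand: "pole_H = (fst pole_H, Inr False, Inr True)"
  by (simp add: pole_H_def parallel_pole_def split_beta Let_def)

lemma pole_H2_expand: "pole_H2 = (fst pole_H2, (1, Inr False), (2, Inr True))"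
proof -
  have "snd (join_two (K, s, t)) = ((1, s), (2, t))" for K :: "'a graph" and s t
    by (simp add: join_two_def)
  then have "snd pole_H2 = ((1, Inr False), (2, Inr True))"
    unfolding pole_H2_def by (subst pole_H_expand)
  then show ?thesis
    by (metis prod.collapse)
qed

text \<open>The part of \<open>H\<close> away from its terminal edges, in the role of
  \<open>E\<close> in \<open>edges_join_two\<close>.\<close>

definition E_H :: "((nat \<times> nat) + bool) set set" where
  "E_H = (\<Union>p\<in>{1, 2}. (`) (\<lambda>v. Inl (if v = 11 \<or> v = 12 then 1 else p, v)) ` EP)"

lemma edges_pole_H:
  "edges (fst pole_H) = {{Inl (1, 11), Inr False}, {Inl (1, 12), Inr True}} \<union> E_H"
  unfolding E_H_def pole_H_def by (subst (1) pole_P_expand) (rule edges_parallel_pole)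

lemma Inr_notin_E_H: "Inr b \<notin> \<Union>E_H"
  by (auto simp: E_H_def)

lemma edges_pole_H2:
  "edges (fst pole_H2) =
     {{(1, Inl (1, 11)), (1, Inr False)}, {(2, Inl (1, 12)), (2, Inr True)}} \<union>
     ({{(1, Inl (1, 12)), (2, Inl (1, 11))}} \<union> (\<Union>h\<in>{1, 2}. (`) (Pair h) ` E_H))"
  unfolding pole_H2_def
  by (subst pole_H_expand, subst edges_join_two[OF edges_pole_H Inr_notin_E_H Inr_notin_E_H])
    (simp_all add: insert_commute)

text \<open>Outside the embedded copies of \<open>P\<close> lie only the edges at the four vertices
  of the complete graph and, for each \<open>i\<close>, the middle edge that suppression leaves
  between the two copies of \<open>H\<close>. The terminal edges of \<open>P\<close> stay inside the
  copies and end at the merged terminals.\<close>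

lemma edges_graph_G:
  "edges graph_G =
     {{Inl 1, Inl 2}, {Inl 1, Inl 3}, {Inl 2, Inl 3}} \<union>
     (\<Union>i\<in>{1, 2, 3}. {{Inl 0, pv i 1 1 11}, {Inl i, pv i 2 1 12}, {pv i 1 1 12, pv i 2 1 11}} \<union>
        (\<Union>h\<in>{1, 2}. \<Union>p\<in>{1, 2}. (`) (emb i h p) ` EP))"
proof -
  let ?E = "{{(1, Inl (1, 12)), (2, Inl (1, 11))}} \<union> (\<Union>h\<in>{1, 2}. (`) (Pair h) ` E_H)"
  have 1: "(1, Inr False) \<notin> \<Union>?E" "(2, Inr True) \<notin> \<Union>?E"
    by (auto simp: E_H_def)
  have 2: "(`) (\<lambda>v. Inr (i, v)) ` ?E =
     {{pv i 1 1 12, pv i 2 1 11}} \<union> (\<Union>h\<in>{1, 2}. \<Union>p\<in>{1, 2}. (`) (emb i h p) ` EP)" for i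
  proof -
    have "emb i h p = (\<lambda>v. pv i h (if v = 11 \<or> v = 12 then 1 else p) v)" for h p
      by (simp add: emb_def fun_eq_iff)
    then show ?thesis
      unfolding E_H_def by (simp add: image_Un image_UN image_image)
  qed
  have "edges graph_G = 
     {{Inl 1, Inl 2}, {Inl 1, Inl 3}, {Inl 2, Inl 3}} \<union>
     (\<Union>i\<in>{1, 2, 3}. {{Inl 0, pv i 1 1 11}, {Inl i, pv i 2 1 12}} \<union>
        (`) (\<lambda>v. Inr (i, v)) ` ?E)"
    unfolding graph_G_def
    by (subst pole_H2_expand, subst edges_attach_to_K4[OF _ edges_pole_H2 1]) simp_all
  from this[unfolded 2] show ?thesis
    by (simp only: Un_insert_left Un_empty_left)
qed

lemma verts_graph_G:
  "verts graph_G = Inl ` {0, 1, 2, 3} \<union>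
     (\<Union>i\<in>{1, 2, 3}. \<Union>h\<in>{1, 2}. {pv i h 1 11, pv i h 1 12} \<union> (\<Union>p\<in>{1, 2}. pv i h p ` {0..<10}))"
proof -
  have H: "verts (fst pole_H) = {Inr False, Inr True} \<union>
     ({Inl (1, 11), Inl (1, 12)} \<union> (\<Union>p\<in>{1, 2}. (\<lambda>v. Inl (p, v)) ` {0..<10}))"
    unfolding pole_H_def pole_P_eq verts_parallel_pole by auto
  have H2: "verts (fst pole_H2) = {1, 2} \<times> verts (fst pole_H) - {(1, Inr True), (2, Inr False)}"
    unfolding pole_H2_def by (subst pole_H_expand, subst verts_join_two) simp_all
  have "verts graph_G = Inl ` {0, 1, 2, 3} \<union>
      Inr ` ({1, 2, 3} \<times> (verts (fst pole_H2) - {(1, Inr False), (2, Inr True)}))"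
    unfolding graph_G_def
    by (subst pole_H2_expand, subst verts_attach_to_K4) (auto simp: H2 H)
  also have "verts (fst pole_H2) - {(1, Inr False), (2, Inr True)} =
      {1, 2} \<times> ({Inl (1, 11), Inl (1, 12)} \<union> (\<Union>p\<in>{1, 2}. (\<lambda>v. Inl (p, v)) ` {0..<10}))"
    unfolding H2 H by auto
  also have "Inr ` ({1, 2, 3} \<times> ({1, 2} \<times> X)) = (\<Union>i\<in>{1, 2, 3}. \<Union>h\<in>{1, 2}. (\<lambda>x. Inr (i, h, x)) ` X)"
    for X :: "(nat \<times> nat + bool) set"
    by (auto simp: image_iff)
  finally show ?thesis
    by (simp add: image_Un image_image)
qed

section \<open>Edges at a given vertex\<close>

lemma inj_emb: "inj (emb i h p)"
  by (auto simp: inj_def emb_def split: if_splits)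

lemma emb_less: "v < 10 \<Longrightarrow> emb i h p v = pv i h p v"
  by (simp add: emb_def)

lemma edges_graph_G_iff:
  "e \<in> edges graph_G \<longleftrightarrow>
     e \<in> {{Inl 1, Inl 2}, {Inl 1, Inl 3}, {Inl 2, Inl 3}} \<or>
     (\<exists>i\<in>{1, 2, 3}. e = {Inl 0, pv i 1 1 11}) \<or> (\<exists>i\<in>{1, 2, 3}. e = {Inl i, pv i 2 1 12}) \<or>
     (\<exists>i\<in>{1, 2, 3}. e = {pv i 1 1 12, pv i 2 1 11}) \<or>
     (\<exists>i\<in>{1, 2, 3}. \<exists>h\<in>{1, 2}. \<exists>p\<in>{1, 2}. \<exists>d\<in>EP. e = emb i h p ` d)"
proof -
  have "x \<in> T \<union> (\<Union>i\<in>I. {a i, b i, c i} \<union> (\<Union>h\<in>J. \<Union>p\<in>K. f i h p ` E)) \<longleftrightarrow>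
      x \<in> T \<or> (\<exists>i\<in>I. x = a i) \<or> (\<exists>i\<in>I. x = b i) \<or> (\<exists>i\<in>I. x = c i) \<or>
      (\<exists>i\<in>I. \<exists>h\<in>J. \<exists>p\<in>K. \<exists>d\<in>E. x = f i h p d)" for x T I a b c J K f E
    by blast
  then show ?thesis
    unfolding edges_graph_G .
qed

lemma edges_graph_G_cases:
  assumes "e \<in> edges graph_G"
  obtains (triangle) "e \<in> {{Inl 1, Inl 2}, {Inl 1, Inl 3}, {Inl 2, Inl 3}}"
  | (bottom) i where "i \<in> {1, 2, 3}" "e = {Inl 0, pv i 1 1 11}"
  | (top) i where "i \<in> {1, 2, 3}" "e = {Inl i, pv i 2 1 12}"
  | (middle) i where "i \<in> {1, 2, 3}" "e = {pv i 1 1 12, pv i 2 1 11}"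
  | (pole) i h p d where "i \<in> {1, 2, 3}" "h \<in> {1, 2}" "p \<in> {1, 2}" "d \<in> EP" "e = emb i h p ` d"
  using assms[unfolded edges_graph_G_iff]
proof (elim disjE bexE)
qed (rule that; assumption)+

lemma emb_image_in_edges:
  assumes "i \<in> {1, 2, 3}" "h \<in> {1, 2}" "p \<in> {1, 2}" "d \<in> EP"
  shows "emb i h p ` d \<in> edges graph_G"
  unfolding edges_graph_G_iff
  by (intro disjI2)
     (intro bexI[OF _ assms(1)] bexI[OF _ assms(2)] bexI[OF _ assms(3)] bexI[OF _ assms(4)] refl)

text \<open>No connecting edge and no other copy reaches an inner vertex of a copy, so degree
  conditions at these ten vertices can be read off \<open>P\<close>.\<close>

lemma incident_pv:
  assumes "i \<in> {1, 2, 3}" "h \<in> {1, 2}" "p \<in> {1, 2}" "v < 10"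
  shows "{e \<in> edges graph_G. pv i h p v \<in> e} = (`) (emb i h p) ` {d \<in> EP. v \<in> d}"
proof
  have "\<exists>d\<in>EP. v \<in> d \<and> e = emb i h p ` d" if e: "e \<in> edges graph_G" "pv i h p v \<in> e" for e
  proof -
    from e(1) show ?thesis
    proof (cases rule: edges_graph_G_cases)
      case (pole i' h' p' d)
      from e(2) have "i' = i" "h' = h" "p' = p" "v \<in> d"
        using assms(4) unfolding pole(5) by (auto simp: emb_def split: if_splits)
      with pole show ?thesis by blast
    qed (use e(2) assms(4) in auto)
  qed
  then show "{e \<in> edges graph_G. pv i h p v \<in> e} \<subseteq> (`) (emb i h p) ` {d \<in> EP. v \<in> d}"
    by blast
  show "(`) (emb i h p) ` {d \<in> EP. v \<in> d} \<subseteq> {e \<in> edges graph_G. pv i h p v \<in> e}"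
  proof clarify
    fix d assume d: "d \<in> EP" "v \<in> d"
    then have "emb i h p v \<in> emb i h p ` d" by blast
    with d(1) show "emb i h p ` d \<in> edges graph_G \<and> pv i h p v \<in> emb i h p ` d"
      using emb_image_in_edges[OF assms(1-3)] emb_less[OF assms(4), of i h p] by metis
  qed
qed

lemma terminal_11_in_iff: "d \<in> EP \<Longrightarrow> 11 \<in> d \<longleftrightarrow> d = {0, 11}"
  and terminal_12_in_iff: "d \<in> EP \<Longrightarrow> 12 \<in> d \<longleftrightarrow> d = {1, 12}"
  by (simp_all add: edges_pole_P) (elim disjE; simp add: doubleton_eq_iff)+

text \<open>Inside \<open>P\<close> only \<open>{0, 11}\<close> reaches the terminal 11, so the two
  parallel copies supply one edge each. The third edge leads out of \<open>H\<close>: to u_0 from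
  the first copy of \<open>H\<close>, along the middle edge from the second.\<close>

lemma incident_left:
  assumes "i \<in> {1, 2, 3}" "h \<in> {1, 2}"
  shows "{e \<in> edges graph_G. pv i h 1 11 \<in> e} =
     {emb i h 1 ` {0, 11}, emb i h 2 ` {0, 11},
      if h = 1 then {Inl 0, pv i 1 1 11} else {pv i 1 1 12, pv i 2 1 11}}" (is "?L = ?R")
proof
  show "?L \<subseteq> ?R"
  proof
    fix e assume "e \<in> ?L"
    then have e: "e \<in> edges graph_G" "pv i h 1 11 \<in> e" by simp_all
    from e(1) show "e \<in> ?R"
    proof (cases rule: edges_graph_G_cases)
      case (pole i' h' p' d)
      from e(2) have "i' = i" "h' = h" "11 \<in> d"
        unfolding pole(5) by (auto simp: emb_def split: if_splits)
      moreover from this pole(4) have "d = {0, 11}"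
        using terminal_11_in_iff by blast
      ultimately show ?thesis using pole(3,5) by auto
    qed (use e(2) in auto)
  qed
  have "{0, 11} \<in> EP" by (simp add: edges_pole_P)
  then have "emb i h p ` {0, 11} \<in> edges graph_G" if "p \<in> {1, 2}" for p
    using emb_image_in_edges[OF assms that] by blast
  moreover have "(if h = 1 then {Inl 0, pv i 1 1 11} else {pv i 1 1 12, pv i 2 1 11}) \<in> edges graph_G"
    unfolding edges_graph_G_iff using assms(1) by auto
  ultimately show "?R \<subseteq> ?L"
    using assms(2) by (auto simp: emb_def)
qed

lemma incident_right:
  assumes "i \<in> {1, 2, 3}" "h \<in> {1, 2}"
  shows "{e \<in> edges graph_G. pv i h 1 12 \<in> e} =
     {emb i h 1 ` {1, 12}, emb i h 2 ` {1, 12},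
      if h = 1 then {pv i 1 1 12, pv i 2 1 11} else {Inl i, pv i 2 1 12}}" (is "?L = ?R")
proof
  show "?L \<subseteq> ?R"
  proof
    fix e assume "e \<in> ?L"
    then have e: "e \<in> edges graph_G" "pv i h 1 12 \<in> e" by simp_all
    from e(1) show "e \<in> ?R"
    proof (cases rule: edges_graph_G_cases)
      case (pole i' h' p' d)
      from e(2) have "i' = i" "h' = h" "12 \<in> d"
        unfolding pole(5) by (auto simp: emb_def split: if_splits)
      moreover from this pole(4) have "d = {1, 12}"
        using terminal_12_in_iff by blast
      ultimately show ?thesis using pole(3,5) by auto
    qed (use e(2) in auto)
  qed
  have "{1, 12} \<in> EP" by (simp add: edges_pole_P)
  then have "emb i h p ` {1, 12} \<in> edges graph_G" if "p \<in> {1, 2}" for p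
    using emb_image_in_edges[OF assms that] by blast
  moreover have "(if h = 1 then {pv i 1 1 12, pv i 2 1 11} else {Inl i, pv i 2 1 12}) \<in> edges graph_G"
    unfolding edges_graph_G_iff using assms(1) by auto
  ultimately show "?R \<subseteq> ?L"
    using assms(2) by (auto simp: emb_def)
qed

lemma incident_Inl_0:
  "{e \<in> edges graph_G. Inl 0 \<in> e} = {{Inl 0, pv 1 1 1 11}, {Inl 0, pv 2 1 1 11}, {Inl 0, pv 3 1 1 11}}"
  (is "?L = ?R")
proof
  show "?L \<subseteq> ?R"
  proof
    fix e assume "e \<in> ?L"
    then have e: "e \<in> edges graph_G" "Inl 0 \<in> e" by simp_all
    from e(1) show "e \<in> ?R"
      by (cases rule: edges_graph_G_cases) (use e(2) in \<open>auto simp: emb_def split: if_splits\<close>)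
  qed
  show "?R \<subseteq> ?L"
    by (auto simp: edges_graph_G_iff)
qed

section \<open>Even subgraphs and colourings of the Petersen graph\<close>

text \<open>
  The Boolean \<open>exy\<close> tells whether the edge \<open>{x, y}\<close> belongs to an even subgraph of \<open>P\<close>, and \<open>s\<close>, \<open>t\<close>
  refer to the terminal edges at 0 and 1. The disjuncts of the second lemma are the ten isolated
  vertices and, for each of the six 2-factors of the Petersen graph, the boundary of one of its
  pentagons, chosen to avoid the edge \<open>{0, 1}\<close>.
\<close>

lemma petersen_parity_bool:
  fixes s t e04 e05 e12 e16 e23 e27 e34 e38 e49 e57 e58 e68 e69 e79 :: bool
  assumes "(s = e04) = (\<not> e05)" "(t = e12) = (\<not> e16)" "(e12 = e23) = (\<not> e27)"
    "(e23 = e34) = (\<not> e38)" "(e34 = e04) = (\<not> e49)" "(e05 = e57) = (\<not> e58)"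
    "(e16 = e69) = (\<not> e68)" "(e27 = e57) = (\<not> e79)" "(e38 = e68) = (\<not> e58)"
    "(e49 = e79) = (\<not> e69)"
  shows "s = t"
  \<comment> \<open>Each hypothesis says that an even number of its three edges is present. In the
    sum of all ten parities every inner edge counts twice, which leaves \<open>s\<close> and
    \<open>t\<close>.\<close>
  using assms by sat

lemma petersen_odd_bool:
  fixes s t e04 e05 e12 e16 e23 e27 e34 e38 e49 e57 e58 e68 e69 e79 :: bool
  assumes "(s = e04) = (\<not> e05)" "(t = e12) = (\<not> e16)" "(e12 = e23) = (\<not> e27)"
    "(e23 = e34) = (\<not> e38)" "(e34 = e04) = (\<not> e49)" "(e05 = e57) = (\<not> e58)"
    "(e16 = e69) = (\<not> e68)" "(e27 = e57) = (\<not> e79)" "(e38 = e68) = (\<not> e58)"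
    "(e49 = e79) = (\<not> e69)"
  shows "\<not> s \<and> \<not> e04 \<and> \<not> e05 \<or> \<not> t \<and> \<not> e12 \<and> \<not> e16 \<or> \<not> e12 \<and> \<not> e23 \<and> \<not> e27 \<or>
    \<not> e23 \<and> \<not> e34 \<and> \<not> e38 \<or> \<not> e34 \<and> \<not> e04 \<and> \<not> e49 \<or> \<not> e05 \<and> \<not> e57 \<and> \<not> e58 \<or>
    \<not> e16 \<and> \<not> e69 \<and> \<not> e68 \<or> \<not> e27 \<and> \<not> e57 \<and> \<not> e79 \<or> \<not> e38 \<and> \<not> e68 \<and> \<not> e58 \<or>
    \<not> e49 \<and> \<not> e79 \<and> \<not> e69 \<or>
    \<not> e05 \<and> \<not> e16 \<and> \<not> e27 \<and> \<not> e38 \<and> \<not> e49 \<or>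
    \<not> e23 \<and> \<not> e04 \<and> \<not> e79 \<and> \<not> e16 \<and> \<not> e58 \<or>
    \<not> e12 \<and> \<not> e04 \<and> \<not> e38 \<and> \<not> e69 \<and> \<not> e57 \<or>
    \<not> e12 \<and> \<not> e34 \<and> \<not> e05 \<and> \<not> e79 \<and> \<not> e68 \<or>
    \<not> s \<and> \<not> e49 \<and> \<not> e23 \<and> \<not> e68 \<and> \<not> e57 \<or>
    \<not> s \<and> \<not> e34 \<and> \<not> e69 \<and> \<not> e27 \<and> \<not> e58"
  \<comment> \<open>As \<open>s\<close> equals \<open>t\<close>, this is an even subgraph of the
    Petersen graph. Without isolated vertices all degrees are 2, so the missing edges form one of
    the six perfect matchings, each consisting of the edges that leave a pentagon.\<close>
  using assms by sat

text \<open>Turns the evenness of a degree at a cubic vertex into the propositional form of the two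
  lemmas above.\<close>

lemma even_card_three:
  assumes "a \<noteq> b" "a \<noteq> c" "b \<noteq> c"
  shows "even (card {d \<in> {a, b, c}. P d}) \<longleftrightarrow> ((P a = P b) = (\<not> P c))"
proof -
  have "{d \<in> {a, b, c}. P d} =
      (if P a then {a} else {}) \<union> (if P b then {b} else {}) \<union> (if P c then {c} else {})"
    by auto
  then show ?thesis using assms by auto
qed

lemma incident_pole_P:
  "{d \<in> EP. 0 \<in> d} = {{0, 11}, {0, 4}, {0, 5}}"
  "{d \<in> EP. 1 \<in> d} = {{1, 12}, {1, 2}, {1, 6}}"
  "{d \<in> EP. 2 \<in> d} = {{1, 2}, {2, 3}, {2, 7}}"
  "{d \<in> EP. 3 \<in> d} = {{2, 3}, {3, 4}, {3, 8}}"
  "{d \<in> EP. 4 \<in> d} = {{3, 4}, {0, 4}, {4, 9}}"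
  "{d \<in> EP. 5 \<in> d} = {{0, 5}, {5, 7}, {5, 8}}"
  "{d \<in> EP. 6 \<in> d} = {{1, 6}, {6, 9}, {6, 8}}"
  "{d \<in> EP. 7 \<in> d} = {{2, 7}, {5, 7}, {7, 9}}"
  "{d \<in> EP. 8 \<in> d} = {{3, 8}, {6, 8}, {5, 8}}"
  "{d \<in> EP. 9 \<in> d} = {{4, 9}, {7, 9}, {6, 9}}"
proof -
  have "{d \<in> EP. v \<in> d} = EP - {d. v \<notin> d}" for v
    by blast
  then show
    "{d \<in> EP. 0 \<in> d} = {{0, 11}, {0, 4}, {0, 5}}"
    "{d \<in> EP. 1 \<in> d} = {{1, 12}, {1, 2}, {1, 6}}"
    "{d \<in> EP. 2 \<in> d} = {{1, 2}, {2, 3}, {2, 7}}"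
    "{d \<in> EP. 3 \<in> d} = {{2, 3}, {3, 4}, {3, 8}}"
    "{d \<in> EP. 4 \<in> d} = {{3, 4}, {0, 4}, {4, 9}}"
    "{d \<in> EP. 5 \<in> d} = {{0, 5}, {5, 7}, {5, 8}}"
    "{d \<in> EP. 6 \<in> d} = {{1, 6}, {6, 9}, {6, 8}}"
    "{d \<in> EP. 7 \<in> d} = {{2, 7}, {5, 7}, {7, 9}}"
    "{d \<in> EP. 8 \<in> d} = {{3, 8}, {6, 8}, {5, 8}}"
    "{d \<in> EP. 9 \<in> d} = {{4, 9}, {7, 9}, {6, 9}}"
    by (simp_all add: edges_pole_P insert_Diff_if insert_commute)
qed

text \<open>The predicate \<open>f\<close> marks the edges of a subgraph that is even at the inner
  vertices. No marked edge leaves the set \<open>W\<close>, which avoids the terminals, so an odd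
  component must lie inside it.\<close>

lemma pole_P_even:
  assumes even: "\<And>v. v < 10 \<Longrightarrow> even (card {d \<in> EP. v \<in> d \<and> f d})"
  shows "f {0, 11} \<longleftrightarrow> f {1, 12}"
    and "\<exists>W\<subseteq>{0..<10}. odd (card W) \<and> (\<forall>d\<in>EP. f d \<longrightarrow> d \<subseteq> W \<or> d \<inter> W = {})"
proof -
  have *: "(f a = f b) = (\<not> f c)"
    if "{d \<in> EP. v \<in> d} = {a, b, c}" "v < 10" "a \<noteq> b" "a \<noteq> c" "b \<noteq> c" for v a b c
  proof -
    have "{d \<in> EP. v \<in> d \<and> f d} = {d \<in> {a, b, c}. f d}"
      unfolding that(1)[symmetric] by blast
    then show ?thesis
      using even[OF that(2)] even_card_three[OF that(3-5)] by simp
  qed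
  have parity:
    "(f {0, 11} = f {0, 4}) = (\<not> f {0, 5})"
    "(f {1, 12} = f {1, 2}) = (\<not> f {1, 6})"
    "(f {1, 2} = f {2, 3}) = (\<not> f {2, 7})"
    "(f {2, 3} = f {3, 4}) = (\<not> f {3, 8})"
    "(f {3, 4} = f {0, 4}) = (\<not> f {4, 9})"
    "(f {0, 5} = f {5, 7}) = (\<not> f {5, 8})"
    "(f {1, 6} = f {6, 9}) = (\<not> f {6, 8})"
    "(f {2, 7} = f {5, 7}) = (\<not> f {7, 9})"
    "(f {3, 8} = f {6, 8}) = (\<not> f {5, 8})"
    "(f {4, 9} = f {7, 9}) = (\<not> f {6, 9})"
    by (rule *[OF incident_pole_P(1)]
        *[OF incident_pole_P(2)]
        *[OF incident_pole_P(3)]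
        *[OF incident_pole_P(4)]
        *[OF incident_pole_P(5)]
        *[OF incident_pole_P(6)]
        *[OF incident_pole_P(7)]
        *[OF incident_pole_P(8)]
        *[OF incident_pole_P(9)]
        *[OF incident_pole_P(10)]; simp add: doubleton_eq_iff)+
  from parity show "f {0, 11} \<longleftrightarrow> f {1, 12}"
    by (rule petersen_parity_bool)
  show "\<exists>W\<subseteq>{0..<10}. odd (card W) \<and> (\<forall>d\<in>EP. f d \<longrightarrow> d \<subseteq> W \<or> d \<inter> W = {})"
    (is "?Q")
  proof -
    have Q: ?Q if "W \<subseteq> {0..<10}" "odd (card W)" "\<forall>d\<in>EP. f d \<longrightarrow> d \<subseteq> W \<or> d \<inter> W = {}" for W
      using that by blast
    show ?Q
      \<comment> \<open>One witness for each disjunct: the isolated vertex, or the pentagon whose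
        leaving edges are all missing.\<close>
      using petersen_odd_bool[OF parity]
      apply (elim disjE)
      subgoal by (rule Q[of "{0}"]) (simp_all add: edges_pole_P)
      subgoal by (rule Q[of "{1}"]) (simp_all add: edges_pole_P)
      subgoal by (rule Q[of "{2}"]) (simp_all add: edges_pole_P)
      subgoal by (rule Q[of "{3}"]) (simp_all add: edges_pole_P)
      subgoal by (rule Q[of "{4}"]) (simp_all add: edges_pole_P)
      subgoal by (rule Q[of "{5}"]) (simp_all add: edges_pole_P)
      subgoal by (rule Q[of "{6}"]) (simp_all add: edges_pole_P)
      subgoal by (rule Q[of "{7}"]) (simp_all add: edges_pole_P)
      subgoal by (rule Q[of "{8}"]) (simp_all add: edges_pole_P)
      subgoal by (rule Q[of "{9}"]) (simp_all add: edges_pole_P)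
      subgoal by (rule Q[of "{5, 6, 7, 8, 9}"]) (simp_all add: edges_pole_P)
      subgoal by (rule Q[of "{3, 4, 6, 8, 9}"]) (simp_all add: edges_pole_P)
      subgoal by (rule Q[of "{2, 3, 4, 7, 9}"]) (simp_all add: edges_pole_P)
      subgoal by (rule Q[of "{2, 3, 5, 7, 8}"]) (simp_all add: edges_pole_P)
      subgoal by (rule Q[of "{0, 3, 4, 5, 8}"]) (simp_all add: edges_pole_P)
      subgoal by (rule Q[of "{0, 4, 5, 7, 9}"]) (simp_all add: edges_pole_P)
      done
  qed
qed

text \<open>Each colour covers an even number of the ten vertices, so the colour missing at 0 is
  also the one missing at 1. The colouring would thus extend to the Petersen graph, which has none.
  The proof itself is a propositional refutation.\<close>

lemma petersen_minus_edge_not_3_colourable: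
  fixes c :: "nat \<Rightarrow> nat \<Rightarrow> nat"
  assumes "c 0 4 < 3" "c 0 5 < 3" "c 1 2 < 3" "c 1 6 < 3" "c 2 3 < 3" "c 2 7 < 3" "c 3 4 < 3"
    "c 3 8 < 3" "c 4 9 < 3" "c 5 7 < 3" "c 5 8 < 3" "c 6 8 < 3" "c 6 9 < 3" "c 7 9 < 3"
    "c 0 4 \<noteq> c 0 5" "c 1 2 \<noteq> c 1 6" 
    "c 1 2 \<noteq> c 2 3" "c 1 2 \<noteq> c 2 7" "c 2 3 \<noteq> c 2 7"
    "c 2 3 \<noteq> c 3 4" "c 2 3 \<noteq> c 3 8" "c 3 4 \<noteq> c 3 8"
    "c 3 4 \<noteq> c 0 4" "c 3 4 \<noteq> c 4 9" "c 0 4 \<noteq> c 4 9"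
    "c 0 5 \<noteq> c 5 7" "c 0 5 \<noteq> c 5 8" "c 5 7 \<noteq> c 5 8"
    "c 1 6 \<noteq> c 6 9" "c 1 6 \<noteq> c 6 8" "c 6 9 \<noteq> c 6 8"
    "c 2 7 \<noteq> c 5 7" "c 2 7 \<noteq> c 7 9" "c 5 7 \<noteq> c 7 9"
    "c 3 8 \<noteq> c 6 8" "c 3 8 \<noteq> c 5 8" "c 6 8 \<noteq> c 5 8"
    "c 4 9 \<noteq> c 7 9" "c 4 9 \<noteq> c 6 9" "c 7 9 \<noteq> c 6 9"
  shows False
proof -
  \<comment> \<open>The propositional atoms are the equations between an edge colour and 0, 1 or 2:
    every edge has a colour, and adjacent edges do not share any given one.\<close>
  have col: "x = 0 \<or> x = 1 \<or> x = 2" if "x < 3" for x :: nat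
    using that by auto
  have dif: "\<not> (x = k \<and> y = k)" if "x \<noteq> y" for x y k :: nat
    using that by auto
  show False
    using assms(1-14)[THEN col] assms(15-)[THEN dif[where k = 0]]
      assms(15-)[THEN dif[where k = 1]] assms(15-)[THEN dif[where k = 2]]
    by sat
qed

section \<open>Odd components inside closed vertex sets\<close>

text \<open>A closed set is a union of components.\<close>

definition closed_in :: "'a graph \<Rightarrow> 'a set \<Rightarrow> bool" where
  "closed_in F W \<longleftrightarrow> W \<subseteq> verts F \<and> (\<forall>e\<in>edges F. e \<subseteq> W \<or> e \<inter> W = {})"

text \<open>Counting only the components that lie entirely in \<open>X\<close> makes lower bounds
  for disjoint regions additive.\<close>

definition odd_components_in :: "'a graph \<Rightarrow> 'a set \<Rightarrow> 'a set set" where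
  "odd_components_in F X = {C \<in> odd_components F. C \<subseteq> X}"

lemma equiv_reachable: "equiv UNIV ({(x, y). {x, y} \<in> edges F}\<^sup>*)"
proof -
  have "sym {(x, y). {x, y} \<in> edges F}"
    by (auto simp: sym_def insert_commute)
  then show ?thesis
    by (simp add: equiv_def refl_rtrancl sym_rtrancl trans_rtrancl)
qed

lemma reachable_closed:
  assumes "closed_in F W" "x \<in> W" "(x, y) \<in> {(x, y). {x, y} \<in> edges F}\<^sup>*"
  shows "y \<in> W"
  using assms(3,2) by (induction rule: rtrancl_induct) (use assms(1) in \<open>fastforce simp: closed_in_def\<close>)+

lemma components_nonempty: "C \<in> components F \<Longrightarrow> C \<noteq> {}"
  by (auto simp: components_def quotient_def)

lemma components_disjoint:
  assumes "C \<in> components F" "D \<in> components F" "C \<noteq> D"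
  shows "C \<inter> D = {}"
proof -
  have "components F \<subseteq> UNIV // {(x, y). {x, y} \<in> edges F}\<^sup>*"
    unfolding components_def quotient_def by blast
  then show ?thesis
    using assms quotient_disj[OF equiv_reachable] by blast
qed

text \<open>The components that meet \<open>W\<close> partition it; if all were even, so would be
  \<open>card W\<close>.\<close>

lemma odd_component_in_closed:
  assumes W: "closed_in F W" "finite W" "odd (card W)"
  shows "odd_components_in F W \<noteq> {}"
proof -
  define r where "r = {(x, y). {x, y} \<in> edges F}\<^sup>*"
  define \<C> where "\<C> = W // r"
  have sub: "\<C> \<subseteq> components F"
    using W(1) by (auto simp: \<C>_def r_def components_def closed_in_def quotient_def)
  have in_W: "C \<subseteq> W" if "C \<in> \<C>" for C
    using that reachable_closed[OF W(1)] by (auto simp: \<C>_def r_def quotient_def)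
  have "\<Union>\<C> = W"
  proof
    show "W \<subseteq> \<Union>\<C>" by (auto simp: \<C>_def r_def quotient_def)
  qed (use in_W in blast)
  moreover have "2 dvd card (\<Union>\<C>)" if "\<forall>C\<in>\<C>. 2 dvd card C"
    using that W(2) \<open>\<Union>\<C> = W\<close> components_disjoint sub
    by (intro dvd_partition) blast+
  ultimately obtain C where "C \<in> \<C>" "odd (card C)"
    using W(3) by auto
  then show ?thesis
    using sub in_W by (auto simp: odd_components_in_def odd_components_def)
qed

lemma finite_odd_components_in:
  "finite (verts F) \<Longrightarrow> finite (odd_components_in F X)"
  by (auto simp: odd_components_in_def odd_components_def components_def quotient_def)

text \<open>A component is nonempty and so cannot lie in both sets. Components that straddle
  \<open>X\<close> and \<open>Y\<close> are counted on the right only.\<close>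

lemma card_odd_components_in_disjoint:
  assumes "finite (verts F)" "X \<inter> Y = {}"
  shows "card (odd_components_in F X) + card (odd_components_in F Y) \<le> card (odd_components_in F (X \<union> Y))"
proof -
  have "odd_components_in F X \<inter> odd_components_in F Y = {}"
    using assms(2) components_nonempty
    by (fastforce simp: odd_components_in_def odd_components_def)
  then have "card (odd_components_in F X) + card (odd_components_in F Y) =
      card (odd_components_in F X \<union> odd_components_in F Y)"
    using finite_odd_components_in[OF assms(1)] by (simp add: card_Un_disjoint)
  also have "\<dots> \<le> card (odd_components_in F (X \<union> Y))"
    by (intro card_mono finite_odd_components_in assms) (auto simp: odd_components_in_def)
  finally show ?thesis .
qed

lemma card_odd_components_in_UN:
  assumes "finite (verts F)" "finite J" "disjoint_family_on X J"
  shows "(\<Sum>j\<in>J. card (odd_components_in F (X j))) \<le> card (odd_components_in F (\<Union>j\<in>J. X j))"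
  using assms(2,3)
proof (induction J rule: finite_induct)
  case (insert j J)
  then have "X j \<inter> (\<Union>k\<in>J. X k) = {}" "disjoint_family_on X J"
    by (auto simp: disjoint_family_on_def)
  then show ?case
    using insert card_odd_components_in_disjoint[OF assms(1), of "X j" "\<Union>k\<in>J. X k"] by simp
qed simp

lemma one_le_card_odd_components_in:
  assumes "finite (verts F)" "closed_in F W" "odd (card W)" "W \<subseteq> X"
  shows "1 \<le> card (odd_components_in F X)"
proof -
  have "finite W" using assms finite_subset by (auto simp: closed_in_def)
  then have "odd_components_in F W \<noteq> {}"
    by (rule odd_component_in_closed[OF assms(2) _ assms(3)])
  then have "odd_components_in F X \<noteq> {}"
    using assms(4) by (auto simp: odd_components_in_def)
  then show ?thesis
    using finite_odd_components_in[OF assms(1)] by (simp add: Suc_le_eq card_gt_0_iff)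
qed

text \<open>The sets \<open>W\<close> and \<open>X - W\<close> are both closed and of odd size, so
  each contributes an odd component.\<close>

lemma two_le_card_odd_components_in:
  assumes "finite (verts F)" "closed_in F W" "odd (card W)" "W \<subseteq> X" "closed_in F X" "even (card X)"
  shows "2 \<le> card (odd_components_in F X)"
proof -
  have "finite X" using assms finite_subset by (auto simp: closed_in_def)
  have "closed_in F (X - W)"
    unfolding closed_in_def
  proof (intro conjI ballI)
    fix e assume "e \<in> edges F"
    then have "e \<subseteq> W \<or> e \<inter> W = {}" "e \<subseteq> X \<or> e \<inter> X = {}"
      using assms(2,5) by (auto simp: closed_in_def)
    then show "e \<subseteq> X - W \<or> e \<inter> (X - W) = {}" by blast
  qed (use assms(5) in \<open>auto simp: closed_in_def\<close>)
  moreover have "odd (card (X - W))"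
    using assms(3,4,6) card_mono[OF \<open>finite X\<close> assms(4)] \<open>finite X\<close>
    by (simp add: card_Diff_subset finite_subset)
  ultimately have "1 \<le> card (odd_components_in F (X - W))"
    using one_le_card_odd_components_in[OF assms(1)] by blast
  moreover have "1 \<le> card (odd_components_in F W)"
    using one_le_card_odd_components_in[OF assms(1-3)] by blast
  moreover have "W \<union> (X - W) = X" using assms(4) by blast
  ultimately show ?thesis
    using card_odd_components_in_disjoint[OF assms(1), of W "X - W"] by simp
qed

section \<open>Lower bounds for even factors\<close>

lemma finite_verts_graph_G: "finite (verts graph_G)"
  by (simp add: verts_graph_G)

context
  fixes F :: "vertex graph"
  assumes F: "even_factor F graph_G"
begin

private lemma verts_F: "verts F = verts graph_G" and edges_F: "edges F \<subseteq> edges graph_G"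
  using F by (auto simp: even_factor_def spanning_subgraph_def)

private lemma finite_verts_F: "finite (verts F)"
  by (simp add: verts_F finite_verts_graph_G)

private lemma even_three:
  assumes "{e \<in> edges graph_G. x \<in> e} = {a, b, c}" "x \<in> verts graph_G" "a \<noteq> b" "a \<noteq> c" "b \<noteq> c"
  shows "((a \<in> edges F) = (b \<in> edges F)) = (c \<notin> edges F)"
proof -
  have "{e \<in> edges F. x \<in> e} = {e \<in> {a, b, c}. e \<in> edges F}"
    unfolding assms(1)[symmetric] using edges_F by blast
  moreover have "even (degree F x)"
    using F assms(2) by (simp add: even_factor_def)
  ultimately have "even (card {e \<in> {a, b, c}. e \<in> edges F})"
    by (simp only: degree_def)
  then show ?thesis
    using even_card_three[OF assms(3-5), of "\<lambda>e. e \<in> edges F"] by simp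
qed

section \<open>Even factors inside one copy of \<open>P\<close>\<close>

context
  fixes i h p :: nat
  assumes ihp: "i \<in> {1, 2, 3}" "h \<in> {1, 2}" "p \<in> {1, 2}"
begin

lemma pv_in_verts: "v < 10 \<Longrightarrow> pv i h p v \<in> verts graph_G"
  using ihp by (auto simp: verts_graph_G)

text \<open>Because \<open>emb i h p\<close> is injective, the evenness of \<open>F\<close> at the
  inner vertices becomes the hypothesis of \<open>pole_P_even\<close> for the preimage of
  \<open>F\<close> in \<open>P\<close>.\<close>

lemma even_copy:
  assumes "v < 10"
  shows "even (card {d \<in> EP. v \<in> d \<and> emb i h p ` d \<in> edges F})"
proof -
  have "{e \<in> edges F. pv i h p v \<in> e} = {e \<in> {e \<in> edges graph_G. pv i h p v \<in> e}. e \<in> edges F}"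
    using edges_F by blast
  also have "\<dots> = (`) (emb i h p) ` {d \<in> EP. v \<in> d \<and> emb i h p ` d \<in> edges F}"
    unfolding incident_pv[OF ihp assms] by blast
  finally have "degree F (pv i h p v) = card {d \<in> EP. v \<in> d \<and> emb i h p ` d \<in> edges F}"
    unfolding degree_def
    by (simp add: card_image
        inj_on_subset[OF inj_on_image[OF inj_on_subset[OF inj_emb subset_UNIV]] subset_UNIV])
  moreover have "even (degree F (pv i h p v))"
    using F pv_in_verts[OF assms] by (simp add: even_factor_def)
  ultimately show ?thesis by simp
qed

lemma traversal: "emb i h p ` {0, 11} \<in> edges F \<longleftrightarrow> emb i h p ` {1, 12} \<in> edges F"
  by (rule pole_P_even(1)[OF even_copy])

text \<open>An edge of \<open>F\<close> at an inner vertex comes from the same copy of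
  \<open>P\<close>, so closedness can be checked in \<open>P\<close>. An edge inside
  \<open>W\<close> avoids the terminals, where alone \<open>emb\<close> and \<open>pv\<close> can
  differ.\<close>

lemma closed_in_copy:
  assumes W: "W \<subseteq> {0..<10}" "\<And>d. d \<in> EP \<Longrightarrow> emb i h p ` d \<in> edges F \<Longrightarrow> d \<subseteq> W \<or> d \<inter> W = {}"
  shows "closed_in F (pv i h p ` W)"
  unfolding closed_in_def
proof (intro conjI ballI)
  show "pv i h p ` W \<subseteq> verts F"
    using W(1) pv_in_verts by (auto simp: verts_F)
  fix e assume e: "e \<in> edges F"
  show "e \<subseteq> pv i h p ` W \<or> e \<inter> pv i h p ` W = {}"
  proof (rule disjCI)
    assume "e \<inter> pv i h p ` W \<noteq> {}"
    then obtain v where v: "v \<in> W" "pv i h p v \<in> e" by blast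
    then have "e \<in> {e \<in> edges graph_G. pv i h p v \<in> e}"
      using e edges_F by blast
    moreover have "v < 10" using v(1) W(1) by auto
    ultimately have "e \<in> (`) (emb i h p) ` {d \<in> EP. v \<in> d}"
      by (simp only: incident_pv[OF ihp])
    then obtain d where d: "d \<in> EP" "v \<in> d" "e = emb i h p ` d" by blast
    then have "d \<subseteq> W" using W(2)[of d] v(1) e by blast
    then have "emb i h p ` d = pv i h p ` d"
      by (intro image_cong) (use W(1) in \<open>auto intro!: emb_less\<close>)
    with \<open>d \<subseteq> W\<close> show "e \<subseteq> pv i h p ` W"
      unfolding d(3) by blast
  qed
qed

text \<open>The odd set from \<open>pole_P_even\<close> yields one odd component. If the copy is not
  traversed, its ten inner vertices form a closed set as well, and their even number forces a second
  one.\<close>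

lemma copy_bound:
  "(if emb i h p ` {0, 11} \<in> edges F then 1 else 2) \<le> card (odd_components_in F (pv i h p ` {0..<10}))"
proof -
  obtain W where W: "W \<subseteq> {0..<10}" "odd (card W)"
    "\<forall>d\<in>EP. emb i h p ` d \<in> edges F \<longrightarrow> d \<subseteq> W \<or> d \<inter> W = {}"
    using pole_P_even(2)[OF even_copy] by blast
  have inj: "inj (pv i h p)" by (simp add: inj_def)
  have 1: "closed_in F (pv i h p ` W)"
    using W by (intro closed_in_copy) auto
  have 2: "odd (card (pv i h p ` W))"
    using W(2) card_image[OF inj_on_subset[OF inj subset_UNIV]] by simp
  have 3: "pv i h p ` W \<subseteq> pv i h p ` {0..<10}"
    using W(1) by blast
  show ?thesis
  proof (cases "emb i h p ` {0, 11} \<in> edges F")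
    case True
    then show ?thesis
      using one_le_card_odd_components_in[OF finite_verts_F 1 2 3] by simp
  next
    case False
    have "d \<subseteq> {0..<10} \<or> d \<inter> {0..<10} = {}" if "d \<in> EP" "emb i h p ` d \<in> edges F" for d
    proof -
      have "d \<noteq> {0, 11}" "d \<noteq> {1, 12}" using that(2) False traversal by blast+
      with that(1) show ?thesis unfolding edges_pole_P by (elim insertE) auto
    qed
    then have 4: "closed_in F (pv i h p ` {0..<10})"
      by (intro closed_in_copy) auto
    have 5: "even (card (pv i h p ` {0..<10}))"
      using card_image[OF inj_on_subset[OF inj subset_UNIV]] by simp
    show ?thesis
      using two_le_card_odd_components_in[OF finite_verts_F 1 2 3 4 5] False by simp
  qed
qed

end

text \<open>These are the degree parities at the two merged terminals of \<open>H\<close>. In the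
  second one, \<open>traversal\<close> replaces the terminal edges at 12 by those at 11, so the two
  edges leading out of \<open>H\<close> are governed by the same pair.\<close>

private lemma H2_parity:
  assumes i: "i \<in> {1, 2, 3}" and h: "h \<in> {1, 2}"
  shows "((emb i h 1 ` {0, 11} \<in> edges F) = (emb i h 2 ` {0, 11} \<in> edges F)) =
     ((if h = 1 then {Inl 0, pv i 1 1 11} else {pv i 1 1 12, pv i 2 1 11}) \<notin> edges F)"
   "((emb i h 1 ` {0, 11} \<in> edges F) = (emb i h 2 ` {0, 11} \<in> edges F)) =
     ((if h = 1 then {pv i 1 1 12, pv i 2 1 11} else {Inl i, pv i 2 1 12}) \<notin> edges F)"
proof -
  have v: "pv i h 1 11 \<in> verts graph_G" "pv i h 1 12 \<in> verts graph_G"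
    using i h by (auto simp: verts_graph_G)
  show "((emb i h 1 ` {0, 11} \<in> edges F) = (emb i h 2 ` {0, 11} \<in> edges F)) =
     ((if h = 1 then {Inl 0, pv i 1 1 11} else {pv i 1 1 12, pv i 2 1 11}) \<notin> edges F)"
    by (rule even_three[OF incident_left[OF i h] v(1)]) (auto simp: emb_def doubleton_eq_iff)
  have "((emb i h 1 ` {1, 12} \<in> edges F) = (emb i h 2 ` {1, 12} \<in> edges F)) =
     ((if h = 1 then {pv i 1 1 12, pv i 2 1 11} else {Inl i, pv i 2 1 12}) \<notin> edges F)"
    by (rule even_three[OF incident_right[OF i h] v(2)]) (auto simp: emb_def doubleton_eq_iff)
  then show "((emb i h 1 ` {0, 11} \<in> edges F) = (emb i h 2 ` {0, 11} \<in> edges F)) =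
     ((if h = 1 then {pv i 1 1 12, pv i 2 1 11} else {Inl i, pv i 2 1 12}) \<notin> edges F)"
    using traversal[OF i h] by simp
qed

private lemma H2_traversal:
  assumes "i \<in> {1, 2, 3}"
  shows "{Inl 0, pv i 1 1 11} \<in> edges F \<longleftrightarrow> {pv i 1 1 12, pv i 2 1 11} \<in> edges F"
    and "{Inl 0, pv i 1 1 11} \<in> edges F \<longleftrightarrow> {Inl i, pv i 2 1 12} \<in> edges F"
  using H2_parity[OF assms, of 1] H2_parity[OF assms, of 2] by auto

text \<open>An edge leading out of \<open>H\<close> is used exactly when one of its two parallel
  copies is traversed and the other is not, which gives 1 + 2 odd components. Otherwise there are at
  least 1 + 1 or 2 + 2.\<close>

private lemma H2_bound:
  assumes i: "i \<in> {1, 2, 3}"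
  shows "4 + 2 * of_bool ({Inl 0, pv i 1 1 11} \<in> edges F) \<le>
    (\<Sum>h\<in>{1, 2}. \<Sum>p\<in>{1, 2}. card (odd_components_in F (pv i h p ` {0..<10})))"
proof -
  have "2 + of_bool ({Inl 0, pv i 1 1 11} \<in> edges F) \<le>
      (\<Sum>p\<in>{1, 2}. card (odd_components_in F (pv i h p ` {0..<10})))" if h: "h \<in> {1, 2}" for h
  proof -
    have "((emb i h 1 ` {0, 11} \<in> edges F) = (emb i h 2 ` {0, 11} \<in> edges F)) =
        ({Inl 0, pv i 1 1 11} \<notin> edges F)"
      using H2_parity(1)[OF i h] H2_traversal[OF i] by simp
    then show ?thesis
      using copy_bound[OF i h, of 1] copy_bound[OF i h, of 2] by (auto split: if_splits)
  qed
  from this[of 1] this[of 2] show ?thesis by simp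
qed

text \<open>The restriction to \<open>range Inr\<close> leaves out the vertices of the complete
  graph, so that odd components among those can be added later.\<close>

private lemma copies_bound:
  "(12 :: nat) + 2 * (\<Sum>i\<in>{1, 2, 3}. of_bool ({Inl 0, pv i 1 1 11} \<in> edges F)) \<le>
     card (odd_components_in F (range Inr))"
proof -
  let ?J = "{1, 2, 3} \<times> {1, 2} \<times> {1, 2}"
  let ?X = "\<lambda>(i, h, p). pv i h p ` {0..<10}"
  have "(12 :: nat) + 2 * (\<Sum>i\<in>{1, 2, 3}. of_bool ({Inl 0, pv i 1 1 11} \<in> edges F)) =
      (\<Sum>i\<in>{1, 2, 3}. 4 + 2 * of_bool ({Inl 0, pv i 1 1 11} \<in> edges F))"
    by (simp del: sum_of_bool_eq)
  also have "\<dots> \<le> (\<Sum>i\<in>{1, 2, 3}. \<Sum>h\<in>{1, 2}. \<Sum>p\<in>{1, 2}. card (odd_components_in F (pv i h p ` {0..<10})))"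
    by (intro sum_mono H2_bound)
  also have "\<dots> = (\<Sum>j\<in>?J. card (odd_components_in F (?X j)))"
    unfolding sum.cartesian_product by (rule sum.cong) auto
  also have "\<dots> \<le> card (odd_components_in F (\<Union>j\<in>?J. ?X j))"
  proof (rule card_odd_components_in_UN[OF finite_verts_F])
    show "disjoint_family_on ?X J" for J
      by (auto simp: disjoint_family_on_def)
  qed simp
  also have "\<dots> \<le> card (odd_components_in F (range Inr))"
    by (intro card_mono finite_odd_components_in finite_verts_F) (auto simp: odd_components_in_def)
  finally show ?thesis .
qed

section \<open>The parity at u_0 and the bounds for the whole graph\<close>

private lemma root_parity:
  "(({Inl 0, pv 1 1 1 11} \<in> edges F) = ({Inl 0, pv 2 1 1 11} \<in> edges F)) = ({Inl 0, pv 3 1 1 11} \<notin> edges F)"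
  by (rule even_three[OF incident_Inl_0]) (auto simp: verts_graph_G doubleton_eq_iff)

private lemma odd_components_in_le: "card (odd_components_in F X) \<le> card (odd_components F)"
  using finite_odd_components_in[OF finite_verts_F, of UNIV]
  by (intro card_mono) (auto simp: odd_components_in_def)

text \<open>By parity at u_0, a single used edge there forces a second, which raises the bound to 12
  + 2 * 2.\<close>

lemma odd_components_lower:
  assumes "\<exists>i\<in>{1, 2, 3}. {Inl 0, pv i 1 1 11} \<in> edges F"
  shows "16 \<le> card (odd_components F)"
proof -
  have "2 \<le> (\<Sum>i\<in>{1, 2, 3}. of_bool ({Inl 0, pv i 1 1 11} \<in> edges F) :: nat)"
    using assms root_parity by (auto simp del: sum_of_bool_eq)
  then show ?thesis
    using copies_bound odd_components_in_le[of "range Inr"] by linarith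
qed

lemma odd_components_lower_isolated:
  assumes "\<forall>i\<in>{1, 2, 3}. {Inl 0, pv i 1 1 11} \<notin> edges F"
  shows "14 \<le> card (odd_components F)"
proof -
  have "\<not> Inl 0 \<in> e" if "e \<in> edges F" for e
  proof
    assume "Inl 0 \<in> e"
    with that edges_F have "e \<in> {e \<in> edges graph_G. Inl 0 \<in> e}" by blast
    with that assms show False unfolding incident_Inl_0 by auto
  qed
  then have "closed_in F {Inl 0}"
    by (auto simp: closed_in_def verts_F verts_graph_G)
  then have 1: "1 \<le> card (odd_components_in F {Inl 0})"
    by (intro one_le_card_odd_components_in[OF finite_verts_F, of "{Inl 0}"]) auto
  have "closed_in F {Inl 1, Inl 2, Inl 3}"
    unfolding closed_in_def
  proof (intro conjI ballI)
    fix e assume e: "e \<in> edges F"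
    then have "e \<in> edges graph_G" using edges_F by blast
    then show "e \<subseteq> {Inl 1, Inl 2, Inl 3} \<or> e \<inter> {Inl 1, Inl 2, Inl 3} = {}"
    proof (cases rule: edges_graph_G_cases)
      \<comment> \<open>A used edge from the triangle into a copy of H_2 would, by
        \<open>H2_traversal\<close>, force a used edge at u_0.\<close>
      case (top i)
      then show ?thesis using H2_traversal(2)[of i] assms e by auto
    qed (auto simp: emb_def)
  qed (simp add: verts_F verts_graph_G)
  then have 2: "1 \<le> card (odd_components_in F {Inl 1, Inl 2, Inl 3})"
    by (intro one_le_card_odd_components_in[OF finite_verts_F, of "{Inl 1, Inl 2, Inl 3}"]) auto
  have 3: "{Inl 0} \<inter> {Inl 1, Inl 2, Inl 3 :: vertex} = {}" by auto
  have 4: "({Inl 0} \<union> {Inl 1, Inl 2, Inl 3}) \<inter> range Inr = ({} :: vertex set)" by auto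
  show ?thesis
    using copies_bound 1 2 card_odd_components_in_disjoint[OF finite_verts_F 3]
      card_odd_components_in_disjoint[OF finite_verts_F 4]
      odd_components_in_le[of "({Inl 0} \<union> {Inl 1, Inl 2, Inl 3}) \<union> range Inr"]
    by linarith
qed

end

lemma weak_oddness_lower: "even_factor F graph_G \<Longrightarrow> 14 \<le> card (odd_components F)"
  using odd_components_lower[of F] odd_components_lower_isolated[of F] by fastforce

lemma oddness_lower:
  assumes F: "two_factor F graph_G"
  shows "16 \<le> card (odd_components F)"
proof (rule odd_components_lower)
  show "even_factor F graph_G"
    using F by (simp add: two_factor_def even_factor_def)
  have "degree F (Inl 0) = 2"
    using F by (auto simp: two_factor_def verts_graph_G)
  then have "{e \<in> edges F. Inl 0 \<in> e} \<noteq> {}"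
    unfolding degree_def by (metis card.empty zero_neq_numeral)
  then obtain e where e: "e \<in> edges F" "Inl 0 \<in> e" by blast
  moreover have "edges F \<subseteq> edges graph_G"
    using F by (simp add: two_factor_def spanning_subgraph_def)
  ultimately have "e \<in> {e \<in> edges graph_G. Inl 0 \<in> e}" by blast
  with e(1) show "\<exists>i\<in>{1, 2, 3}. {Inl 0, pv i 1 1 11} \<in> edges F"
    unfolding incident_Inl_0 by auto
qed

section \<open>Graphs given by lists of circuits\<close>

text \<open>A list of length 1 stands for an isolated vertex; pairing it with its rotation would
  give a degenerate edge instead.\<close>

definition cycle_edges :: "'a list \<Rightarrow> 'a set set" where
  "cycle_edges xs = (if length xs = 1 then {} else set (map2 (\<lambda>x y. {x, y}) xs (rotate1 xs)))"

definition cycle_graph :: "'a list list \<Rightarrow> 'a graph" where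
  "cycle_graph css = \<lparr>verts = set (concat css), edges = (\<Union>xs\<in>set css. cycle_edges xs)\<rparr>"

lemma cycle_edges_nth:
  assumes "length xs \<noteq> 1"
  shows "cycle_edges xs = (\<lambda>k. {xs ! k, xs ! (Suc k mod length xs)}) ` {..<length xs}"
proof -
  have "cycle_edges xs = {map2 (\<lambda>x y. {x, y}) xs (rotate1 xs) ! k | k. k < length xs}"
    using assms by (simp add: cycle_edges_def set_conv_nth)
  also have "\<dots> = {{xs ! k, xs ! (Suc k mod length xs)} | k. k < length xs}"
    by (intro Collect_cong ex_cong1) (auto simp: nth_rotate1)
  finally show ?thesis by blast
qed

lemma cycle_edges_subset: "e \<in> cycle_edges xs \<Longrightarrow> e \<subseteq> set xs"
proof (cases "length xs = 1")
  case False
  assume "e \<in> cycle_edges xs"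
  then obtain k where "k < length xs" "e = {xs ! k, xs ! (Suc k mod length xs)}"
    unfolding cycle_edges_nth[OF False] by blast
  moreover from this(1) have "Suc k mod length xs < length xs"
    by (intro mod_less_divisor) auto
  ultimately show ?thesis by simp
qed (simp add: cycle_edges_def)

lemma card_cycle_edges_at:
  assumes xs: "distinct xs" "3 \<le> length xs" and x: "x \<in> set xs"
  shows "card {e \<in> cycle_edges xs. x \<in> e} = 2"
proof -
  define n where "n = length xs"
  have n: "length xs \<noteq> 1" "3 \<le> n" using xs by (auto simp: n_def)
  obtain j where j: "j < n" "x = xs ! j"
    using x by (auto simp: in_set_conv_nth n_def)
  define f where "f = (\<lambda>k. {xs ! k, xs ! (Suc k mod n)})"
  \<comment> \<open>The cyclic predecessor of \<open>j\<close>. Since \<open>f k\<close> joins entry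
    \<open>k\<close> to the next entry, \<open>x\<close> lies on \<open>f j\<close> and
    \<open>f i\<close> only.\<close>
  define i where "i = (if j = 0 then n - 1 else j - 1)"
  have i: "i < n" "Suc i mod n = j" "i \<noteq> j" "Suc j mod n \<noteq> i" "Suc j mod n < n" "Suc j mod n \<noteq> j"
    using j(1) n(2) by (auto simp: i_def mod_Suc)
  have at: "x \<in> f k \<longleftrightarrow> k = j \<or> k = i" if "k < n" for k
  proof -
    have "Suc k mod n < n" using n(2) by simp
    then have "x \<in> f k \<longleftrightarrow> j = k \<or> j = Suc k mod n"
      using that j xs(1) by (auto simp: f_def n_def nth_eq_iff_index_eq)
    also have "j = Suc k mod n \<longleftrightarrow> k = i"
      using that j(1) n(2) by (auto simp: i_def mod_Suc split: if_splits)
    finally show ?thesis by auto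
  qed
  have "{e \<in> cycle_edges xs. x \<in> e} = f ` {k \<in> {..<n}. x \<in> f k}"
    unfolding cycle_edges_nth[OF n(1)] f_def n_def by blast
  also have "{k \<in> {..<n}. x \<in> f k} = {j, i}"
    using at i(1) j(1) by auto
  finally have "{e \<in> cycle_edges xs. x \<in> e} = {f j, f i}" by simp
  \<comment> \<open>This is where length at least 3 matters: the entries before and after
    \<open>x\<close> differ.\<close>
  moreover have "f j \<noteq> f i"
    using xs(1) i j(1) by (auto simp: f_def doubleton_eq_iff nth_eq_iff_index_eq n_def)
  ultimately show ?thesis by simp
qed

context
  fixes css :: "'a list list"
  assumes dist: "distinct (concat css)"
begin

private lemma cycles_disjoint:
  assumes "ys \<in> set css" "zs \<in> set css" "x \<in> set ys" "x \<in> set zs"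
  shows "ys = zs"
  using dist assms unfolding distinct_concat_iff by blast

lemma incident_cycle_graph:
  assumes "xs \<in> set css" "x \<in> set xs"
  shows "{e \<in> edges (cycle_graph css). x \<in> e} = {e \<in> cycle_edges xs. x \<in> e}"
proof -
  have "ys = xs" if "ys \<in> set css" "e \<in> cycle_edges ys" "x \<in> e" for ys e
    using cycles_disjoint[OF that(1) assms(1) _ assms(2)] cycle_edges_subset[OF that(2)] that(3) by blast
  then show ?thesis
    using assms(1) unfolding cycle_graph_def by (simp, blast)
qed

lemma degree_cycle_graph:
  assumes "xs \<in> set css" "x \<in> set xs"
  shows "length xs = 1 \<Longrightarrow> degree (cycle_graph css) x = 0"
    and "3 \<le> length xs \<Longrightarrow> degree (cycle_graph css) x = 2"
proof -
  show "degree (cycle_graph css) x = 0" if "length xs = 1"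
    unfolding degree_def incident_cycle_graph[OF assms] using that by (simp add: cycle_edges_def)
  have "distinct xs" using dist assms(1) by (simp add: distinct_concat_iff)
  then show "degree (cycle_graph css) x = 2" if "3 \<le> length xs"
    unfolding degree_def incident_cycle_graph[OF assms]
    using that assms(2) by (rule card_cycle_edges_at)
qed

text \<open>The vertex set of a circuit is closed because the lists are disjoint, and connected
  because every entry is reached from the first one along the list.\<close>

lemma components_cycle_graph: "components (cycle_graph css) \<subseteq> set ` set css"
proof
  define r where "r = {(x, y). {x, y} \<in> edges (cycle_graph css)}\<^sup>*"
  fix C assume "C \<in> components (cycle_graph css)"
  then obtain xs x where xs: "xs \<in> set css" "x \<in> set xs" "C = r `` {x}"
    by (auto simp: components_def quotient_def r_def cycle_graph_def)
  have closed: "closed_in (cycle_graph css) (set xs)"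
    unfolding closed_in_def
  proof (intro conjI ballI)
    show "set xs \<subseteq> verts (cycle_graph css)"
      using xs(1) by (auto simp: cycle_graph_def)
    fix e assume "e \<in> edges (cycle_graph css)"
    then obtain ys where ys: "ys \<in> set css" "e \<in> cycle_edges ys"
      by (auto simp: cycle_graph_def)
    then show "e \<subseteq> set xs \<or> e \<inter> set xs = {}"
      using cycles_disjoint[OF ys(1) xs(1)] cycle_edges_subset[OF ys(2)] by blast
  qed
  have equiv: "equiv UNIV r"
    unfolding r_def by (rule equiv_reachable)
  have "(xs ! 0, xs ! k) \<in> r" if "k < length xs" for k
    using that
  proof (induction k)
    case (Suc k)
    have "length xs \<noteq> 1" using Suc.prems by simp
    have "{xs ! k, xs ! (Suc k mod length xs)} \<in> cycle_edges xs"
      unfolding cycle_edges_nth[OF \<open>length xs \<noteq> 1\<close>] using Suc.prems by (intro imageI) simp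
    then have "{xs ! k, xs ! Suc k} \<in> edges (cycle_graph css)"
      using Suc.prems xs(1) by (auto simp: cycle_graph_def)
    then show ?case
      using Suc unfolding r_def by (auto intro: rtrancl_into_rtrancl)
  qed (simp add: r_def)
  then have "(xs ! 0, y) \<in> r" if "y \<in> set xs" for y
    using that by (auto simp: in_set_conv_nth)
  then have "(x, y) \<in> r" if "y \<in> set xs" for y
    using that xs(2) equiv by (meson equiv_def symD transD)
  moreover have "y \<in> set xs" if "(x, y) \<in> r" for y
    using reachable_closed[OF closed xs(2)] that by (simp add: r_def)
  ultimately have "C = set xs"
    using xs(3) by blast
  with xs(1) show "C \<in> set ` set css" by blast
qed

lemma card_odd_components_cycle_graph:
  "card (odd_components (cycle_graph css)) \<le> length (filter (\<lambda>xs. odd (length xs)) css)"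
proof -
  have "odd_components (cycle_graph css) \<subseteq> set ` set (filter (\<lambda>xs. odd (length xs)) css)"
  proof
    fix C assume "C \<in> odd_components (cycle_graph css)"
    then obtain xs where xs: "xs \<in> set css" "C = set xs" "odd (card C)"
      using components_cycle_graph by (auto simp: odd_components_def)
    moreover have "distinct xs" using dist xs(1) by (simp add: distinct_concat_iff)
    ultimately show "C \<in> set ` set (filter (\<lambda>xs. odd (length xs)) css)"
      by (auto simp: distinct_card)
  qed
  then have "card (odd_components (cycle_graph css)) \<le> card (set ` set (filter (\<lambda>xs. odd (length xs)) css))"
    by (intro card_mono) auto
  also have "\<dots> \<le> length (filter (\<lambda>xs. odd (length xs)) css)"
    by (rule order_trans[OF card_image_le card_length]) simp
  finally show ?thesis .
qed

end

section \<open>Optimal factors\<close>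

text \<open>A traversal of \<open>H\<close> between its merged terminals, through the first parallel
  copy of \<open>P\<close> along the outer cycle of the Petersen graph without
  \<open>{0, 1}\<close>.\<close>

definition path :: "nat \<Rightarrow> nat \<Rightarrow> vertex list" where
  "path i h = pv i h 1 11 # map (pv i h 1) [0, 4, 3, 2, 1] @ [pv i h 1 12]"

text \<open>One circuit of length 7 + 5 = 12 passes through both parallel copies, so only the two
  inner pentagrams are odd.\<close>

definition untraversed :: "nat \<Rightarrow> nat \<Rightarrow> vertex list list" where
  "untraversed i h = [path i h @ map (pv i h 2) [1, 2, 3, 4, 0],
     map (pv i h 1) [5, 7, 9, 6, 8], map (pv i h 2) [5, 7, 9, 6, 8]]"

text \<open>What remains of \<open>H\<close> beside \<open>path i h\<close>: the pentagram of the
  first copy and a split of the second copy into two pentagons, hence three odd circuits.\<close>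

definition traversed :: "nat \<Rightarrow> nat \<Rightarrow> vertex list list" where
  "traversed i h = [map (pv i h 1) [5, 7, 9, 6, 8],
     map (pv i h 2) [0, 4, 3, 8, 5], map (pv i h 2) [1, 2, 7, 9, 6]]"

text \<open>The isolated u_0 and the triangle are odd, and each of the six copies of
  \<open>H\<close> adds two, for a total of 2 + 6 * 2 = 14.\<close>

definition weak_cycles :: "vertex list list" where
  "weak_cycles = [[Inl 0], [Inl 1, Inl 2, Inl 3]] @
     untraversed 1 1 @ untraversed 1 2 @ untraversed 2 1 @ untraversed 2 2 @ untraversed 3 1 @ untraversed 3 2"

text \<open>The long circuit goes from u_0 through the first copy of H_2, along the triangle by way
  of u_3, and back through the second copy. Its length 1 + 14 + 3 + 14 is even, so 4 * 3 + 2 * 2 =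
  16 circuits are odd.\<close>

definition two_factor_cycles :: "vertex list list" where
  "two_factor_cycles =
     [Inl 0 # path 1 1 @ path 1 2 @ [Inl 1, Inl 3, Inl 2] @ rev (path 2 1 @ path 2 2)] @
     traversed 1 1 @ traversed 1 2 @ traversed 2 1 @ traversed 2 2 @ untraversed 3 1 @ untraversed 3 2"

lemmas cycles_defs = path_def untraversed_def traversed_def

lemma distinct_weak_cycles: "distinct (concat weak_cycles)"
  by (simp add: weak_cycles_def cycles_defs)

lemma distinct_two_factor_cycles: "distinct (concat two_factor_cycles)"
  by (simp add: two_factor_cycles_def cycles_defs)

lemma copy_verts: "pv i h p ` {0..<10} = {pv i h p 0, pv i h p 1, pv i h p 2, pv i h p 3, pv i h p 4,
    pv i h p 5, pv i h p 6, pv i h p 7, pv i h p 8, pv i h p 9}"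
proof -
  have "{0..<10} = {0, 1, 2, 3, 4, 5, 6, 7, 8, 9 :: nat}" by auto
  then show ?thesis by simp
qed

lemma set_untraversed:
  "set (concat (untraversed i h)) = {pv i h 1 11, pv i h 1 12} \<union> (\<Union>p\<in>{1, 2}. pv i h p ` {0..<10})"
  unfolding copy_verts by (simp add: cycles_defs insert_commute)

lemma set_traversed:
  "set (path i h) \<union> set (concat (traversed i h)) =
     {pv i h 1 11, pv i h 1 12} \<union> (\<Union>p\<in>{1, 2}. pv i h p ` {0..<10})"
  unfolding copy_verts by (simp add: cycles_defs insert_commute)

lemma verts_weak_cycles: "verts (cycle_graph weak_cycles) = verts graph_G"
proof -
  have "verts (cycle_graph weak_cycles) = {Inl 0, Inl 1, Inl 2, Inl 3} \<union>
      (\<Union>i\<in>{1, 2, 3}. \<Union>h\<in>{1, 2}. set (concat (untraversed i h)))"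
    by (simp add: cycle_graph_def weak_cycles_def Un_ac)
  then show ?thesis unfolding set_untraversed verts_graph_G by simp
qed

lemma verts_two_factor_cycles: "verts (cycle_graph two_factor_cycles) = verts graph_G"
proof -
  have "verts (cycle_graph two_factor_cycles) = {Inl 0, Inl 1, Inl 2, Inl 3} \<union>
      ((\<Union>i\<in>{1, 2}. \<Union>h\<in>{1, 2}. set (path i h) \<union> set (concat (traversed i h))) \<union> 
       (\<Union>h\<in>{1, 2}. set (concat (untraversed 3 h))))"
    by (simp add: cycle_graph_def two_factor_cycles_def Un_ac insert_commute)
  also have "\<dots> = verts graph_G"
    unfolding set_untraversed set_traversed verts_graph_G by (simp add: Un_ac insert_commute)
  finally show ?thesis .
qed

lemma copy_edge:
  assumes "i \<in> {1, 2, 3}" "h \<in> {1, 2}" "p \<in> {1, 2}" "{v, w} \<in> EP" "v < 10" "w < 10"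
  shows "{pv i h p v, pv i h p w} \<in> edges graph_G"
  using emb_image_in_edges[OF assms(1-4)] assms(5,6) by (simp add: emb_less)

lemma terminal_edge:
  assumes "i \<in> {1, 2, 3}" "h \<in> {1, 2}" "p \<in> {1, 2}"
  shows "{pv i h 1 11, pv i h p 0} \<in> edges graph_G" "{pv i h p 0, pv i h 1 11} \<in> edges graph_G"
    "{pv i h 1 12, pv i h p 1} \<in> edges graph_G" "{pv i h p 1, pv i h 1 12} \<in> edges graph_G"
proof -
  have "{0, 11} \<in> EP" "{1, 12} \<in> EP" by (simp_all add: edges_pole_P)
  then have "emb i h p ` {0, 11} \<in> edges graph_G" "emb i h p ` {1, 12} \<in> edges graph_G"
    using emb_image_in_edges[OF assms] by blast+
  then show "{pv i h 1 11, pv i h p 0} \<in> edges graph_G" "{pv i h p 0, pv i h 1 11} \<in> edges graph_G"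
    "{pv i h 1 12, pv i h p 1} \<in> edges graph_G" "{pv i h p 1, pv i h 1 12} \<in> edges graph_G"
    by (simp_all add: emb_def insert_commute)
qed

lemma link_edge:
  assumes "i \<in> {1, 2, 3}"
  shows "{Inl 0, pv i 1 1 11} \<in> edges graph_G" "{pv i 1 1 11, Inl 0} \<in> edges graph_G"
    "{Inl i, pv i 2 1 12} \<in> edges graph_G" "{pv i 2 1 12, Inl i} \<in> edges graph_G"
    "{pv i 1 1 12, pv i 2 1 11} \<in> edges graph_G" "{pv i 2 1 11, pv i 1 1 12} \<in> edges graph_G"
proof -
  show bottom: "{Inl 0, pv i 1 1 11} \<in> edges graph_G"
    unfolding edges_graph_G_iff by (rule disjI2, rule disjI1, rule bexI[OF refl assms])
  show top: "{Inl i, pv i 2 1 12} \<in> edges graph_G"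
    unfolding edges_graph_G_iff by (rule disjI2, rule disjI2, rule disjI1, rule bexI[OF refl assms])
  show middle: "{pv i 1 1 12, pv i 2 1 11} \<in> edges graph_G"
    unfolding edges_graph_G_iff
    by (rule disjI2, rule disjI2, rule disjI2, rule disjI1, rule bexI[OF refl assms])
  show "{pv i 1 1 11, Inl 0} \<in> edges graph_G"
    using bottom by (simp only: insert_commute)
  show "{pv i 2 1 12, Inl i} \<in> edges graph_G"
    using top by (simp only: insert_commute)
  show "{pv i 2 1 11, pv i 1 1 12} \<in> edges graph_G"
    using middle by (simp only: insert_commute)
qed

lemma triangle_edge:
  assumes "j \<in> {1, 2, 3}" "k \<in> {1, 2, 3}" "j \<noteq> k"
  shows "{Inl j, Inl k} \<in> edges graph_G"
proof -
  have "{Inl j, Inl k} \<in> {{Inl 1, Inl 2}, {Inl 1, Inl 3}, {Inl 2, Inl 3}}"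
    using assms by (auto simp: insert_commute)
  then show ?thesis
    unfolding edges_graph_G_iff by (rule disjI1)
qed

lemmas edge_rules = copy_edge terminal_edge link_edge triangle_edge

lemma untraversed_edges:
  assumes "i \<in> {1, 2, 3}" "h \<in> {1, 2}"
  shows "\<forall>xs\<in>set (untraversed i h). cycle_edges xs \<subseteq> edges graph_G"
  using assms
  by (simp add: untraversed_def path_def cycle_edges_def edge_rules edges_pole_P doubleton_eq_iff
      del: One_nat_def)

lemma traversed_edges:
  assumes "i \<in> {1, 2, 3}" "h \<in> {1, 2}"
  shows "\<forall>xs\<in>set (traversed i h). cycle_edges xs \<subseteq> edges graph_G"
  using assms
  by (simp add: traversed_def cycle_edges_def edge_rules edges_pole_P doubleton_eq_iff
      del: One_nat_def)

lemma edges_weak_cycles: "edges (cycle_graph weak_cycles) \<subseteq> edges graph_G"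
proof -
  have "cycle_edges [Inl 0] \<subseteq> edges graph_G" "cycle_edges [Inl 1, Inl 2, Inl 3] \<subseteq> edges graph_G"
    by (simp_all add: cycle_edges_def triangle_edge)
  then have "\<forall>xs\<in>set weak_cycles. cycle_edges xs \<subseteq> edges graph_G"
    unfolding weak_cycles_def set_append ball_Un
    by (intro conjI untraversed_edges) simp_all
  then show ?thesis
    by (auto simp: cycle_graph_def)
qed

lemma edges_two_factor_cycles: "edges (cycle_graph two_factor_cycles) \<subseteq> edges graph_G"
proof -
  have "cycle_edges (Inl 0 # path 1 1 @ path 1 2 @ [Inl 1, Inl 3, Inl 2] @ rev (path 2 1 @ path 2 2))
      \<subseteq> edges graph_G"
    by (simp add: path_def cycle_edges_def edge_rules edges_pole_P doubleton_eq_iff del: One_nat_def)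
  then have "\<forall>xs\<in>set two_factor_cycles. cycle_edges xs \<subseteq> edges graph_G"
    unfolding two_factor_cycles_def set_append[of "[_]"] set_append[of "traversed _ _"]
      set_append[of "untraversed _ _"] ball_Un
    by (intro conjI untraversed_edges traversed_edges) simp_all
  then show ?thesis
    by (auto simp: cycle_graph_def)
qed

lemma weak_oddness_upper:
  "\<exists>F. even_factor F graph_G \<and> card (odd_components F) \<le> 14"
proof (intro exI conjI)
  let ?F = "cycle_graph weak_cycles"
  have "\<forall>xs\<in>set weak_cycles. length xs = 1 \<or> 3 \<le> length xs"
    by (simp add: weak_cycles_def cycles_defs)
  then have "even (degree ?F x)" if "x \<in> verts ?F" for x
    using that degree_cycle_graph[OF distinct_weak_cycles] by (fastforce simp: cycle_graph_def)
  then show "even_factor ?F graph_G"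
    using verts_weak_cycles edges_weak_cycles by (simp add: even_factor_def spanning_subgraph_def)
  have "length (filter (\<lambda>xs. odd (length xs)) weak_cycles) = 14"
    by (simp add: weak_cycles_def cycles_defs)
  then show "card (odd_components ?F) \<le> 14"
    using card_odd_components_cycle_graph[OF distinct_weak_cycles] by simp
qed

lemma oddness_upper:
  "\<exists>F. two_factor F graph_G \<and> card (odd_components F) \<le> 16"
proof (intro exI conjI)
  let ?F = "cycle_graph two_factor_cycles"
  have "\<forall>xs\<in>set two_factor_cycles. 3 \<le> length xs"
    by (simp add: two_factor_cycles_def cycles_defs)
  then have "degree ?F x = 2" if "x \<in> verts ?F" for x
    using that degree_cycle_graph(2)[OF distinct_two_factor_cycles] by (fastforce simp: cycle_graph_def)
  then show "two_factor ?F graph_G"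
    using verts_two_factor_cycles edges_two_factor_cycles
    by (simp add: two_factor_def spanning_subgraph_def)
  have "length (filter (\<lambda>xs. odd (length xs)) two_factor_cycles) = 16"
    by (simp add: two_factor_cycles_def cycles_defs)
  then show "card (odd_components ?F) \<le> 16"
    using card_odd_components_cycle_graph[OF distinct_two_factor_cycles] by simp
qed

section \<open>Resistance\<close>

lemma proper_edge_colouring_neq:
  assumes "proper_edge_colouring k c G" "e \<in> edges G" "f \<in> edges G" "e \<noteq> f" "e \<inter> f \<noteq> {}"
  shows "c e \<noteq> c f"
  using assms by (simp add: proper_edge_colouring_def)

text \<open>If \<open>S\<close> missed the copy, all edges among its ten vertices would survive and
  \<open>c\<close> would colour the Petersen graph minus an edge.\<close>

lemma copy_not_colourable:
  assumes c: "proper_edge_colouring 3 c (delete_verts S graph_G)"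
    and ihp: "i \<in> {1, 2, 3}" "h \<in> {1, 2}" "p \<in> {1, 2}"
  shows "S \<inter> pv i h p ` {0..<10} \<noteq> {}"
proof
  assume S: "S \<inter> pv i h p ` {0..<10} = {}"
  let ?e = "\<lambda>v w. {pv i h p v, pv i h p w}"
  have edge: "?e v w \<in> edges (delete_verts S graph_G)" if "{v, w} \<in> EP" "v < 10" "w < 10" for v w
    using copy_edge[OF ihp that] S that(2,3) by (auto simp: delete_verts_def)
  have lt: "c (?e v w) < 3" if "{v, w} \<in> EP" "v < 10" "w < 10" for v w
    using edge[OF that] c by (simp only: proper_edge_colouring_def)
  have ne: "c (?e v w) \<noteq> c (?e v' w')"
    if "{v, w} \<in> EP" "v < 10" "w < 10" "{v', w'} \<in> EP" "v' < 10" "w' < 10"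
      "{v, w} \<noteq> {v', w'}" "{v, w} \<inter> {v', w'} \<noteq> {}" for v w v' w'
  proof -
    have "?e v w \<noteq> ?e v' w'" "?e v w \<inter> ?e v' w' \<noteq> {}"
      using that(7,8) by (auto simp: doubleton_eq_iff)
    then show ?thesis
      by (rule proper_edge_colouring_neq[OF c edge[OF that(1-3)] edge[OF that(4-6)]])
  qed
  show False
    by (rule petersen_minus_edge_not_3_colourable[of "\<lambda>v w. c (?e v w)"])
      (intro lt ne; simp add: edges_pole_P doubleton_eq_iff)+
qed

lemma resistance_lower:
  assumes S: "S \<subseteq> verts graph_G" and c: "proper_edge_colouring 3 c (delete_verts S graph_G)"
  shows "12 \<le> card S"
proof -
  define J :: "(nat \<times> nat \<times> nat) set" where "J = {1, 2, 3} \<times> {1, 2} \<times> {1, 2}"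
  define X where "X = (\<lambda>(i, h, p). pv i h p ` {0..<10})"
  have "\<exists>x. x \<in> S \<inter> X j" if j: "j \<in> J" for j
  proof -
    obtain i h p where "j = (i, h, p)" "i \<in> {1, 2, 3}" "h \<in> {1, 2}" "p \<in> {1, 2}"
      using j unfolding J_def by (cases j rule: prod_cases3) (simp only: mem_Sigma_iff)
    then have "S \<inter> X j \<noteq> {}"
      using copy_not_colourable[OF c, of i h p] by (simp add: X_def)
    then show ?thesis by blast
  qed
  \<comment> \<open>Choosing one deleted vertex in each copy gives an injection, since the copies
    have disjoint inner vertices.\<close>
  then have "\<exists>f. \<forall>j\<in>J. f j \<in> S \<inter> X j"
    by (intro bchoice ballI)
  then obtain f where f: "f j \<in> S" "f j \<in> X j" if "j \<in> J" for j
    by blast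
  have disj: "j = k" if "x \<in> X j" "x \<in> X k" for j k x
    using that by (cases j; cases k) (auto simp: X_def)
  have "inj_on f J"
  proof (rule inj_onI)
    fix j k assume "j \<in> J" "k \<in> J" "f j = f k"
    then show "j = k" using f(2)[of j] f(2)[of k] disj[of "f j" j k] by simp
  qed
  moreover have "f ` J \<subseteq> S" using f(1) by (intro image_subsetI)
  moreover have "finite S" using S finite_verts_graph_G finite_subset by blast
  ultimately have "card J \<le> card S" by (rule card_inj_on_le)
  then show ?thesis by (simp add: J_def)
qed

text \<open>
  The three classes colour \<open>P\<close> without the vertex 9, with distinct colours on the terminal edges.
  The first two are swapped in the second copy of \<open>P\<close>, so both terminal edges of each copy of \<open>H\<close>
  get the third colour; rotating the colours by \<open>i\<close> makes the edges at \<open>u\<^sub>0\<close> distinct.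
\<close>

definition pole_class :: "nat \<Rightarrow> nat list list" where
  "pole_class k = [[[0, 11], [1, 2], [3, 4], [5, 7], [6, 8]],
     [[1, 12], [0, 4], [2, 3], [5, 8]], [[0, 5], [1, 6], [2, 7], [3, 8]]] ! k"

definition part :: "nat \<Rightarrow> nat \<Rightarrow> nat \<Rightarrow> nat \<Rightarrow> vertex list list" where
  "part i h p k = map (map (emb i h p)) (pole_class k)"

definition own_part :: "nat \<Rightarrow> vertex list list" where
  "own_part i = [[Inl 0, pv i 1 1 11], [Inl i, pv i 2 1 12], [pv i 1 1 12, pv i 2 1 11]] @
     part i 1 1 2 @ part i 1 2 2 @ part i 2 1 2 @ part i 2 2 2"

definition cross_part :: "nat \<Rightarrow> nat \<Rightarrow> vertex list list" where
  "cross_part i k = part i 1 1 k @ part i 1 2 (1 - k) @ part i 2 1 k @ part i 2 2 (1 - k)"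

text \<open>The triangle edge opposite u_i gets the colour of the connecting edges of the
  \<open>i\<close>-th copy of H_2. At each u_i the two triangle edges therefore carry the two other
  colours.\<close>

definition colour_class :: "nat \<Rightarrow> vertex list list" where
  "colour_class k =
     [[Inl 2, Inl 3] # own_part 1 @ cross_part 2 0 @ cross_part 3 1,
      [Inl 1, Inl 3] # own_part 2 @ cross_part 3 0 @ cross_part 1 1,
      [Inl 1, Inl 2] # own_part 3 @ cross_part 1 0 @ cross_part 2 1] ! k"

text \<open>Edges are stored as vertex lists, so distinctness of the concatenation says that no
  vertex occurs in two edges of the class.\<close>

lemma colour_class_matching:
  assumes "k < 3" "e \<in> set ` set (colour_class k)" "f \<in> set ` set (colour_class k)" "e \<inter> f \<noteq> {}"
  shows "e = f"
proof -
  have "distinct (concat (colour_class k))"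
    using assms(1) unfolding less_Suc_eq numeral_3_eq_3
    by (auto simp: colour_class_def own_part_def cross_part_def part_def pole_class_def emb_def)
  then show ?thesis
    using assms(2-4) unfolding distinct_concat_iff by blast
qed

lemma ex_less_3I: "X 0 \<or> X 1 \<or> X 2 \<Longrightarrow> \<exists>l<3. X l" for X :: "nat \<Rightarrow> bool"
  by (elim disjE) (rule exI, erule conjI[rotated], simp)+

lemma part_colour_class:
  assumes "i \<in> {1, 2, 3}" "h \<in> {1, 2}" "p \<in> {1, 2}" "k < 3"
  shows "\<exists>l<3. set (part i h p k) \<subseteq> set (colour_class l)"
proof -
  have "k \<in> {0, 1, 2}" using assms(4) by auto
  with assms(1-3) show ?thesis
    by (intro ex_less_3I) (elim insertE emptyE;
      simp add: colour_class_def own_part_def cross_part_def le_supI1 le_supI2 subset_insertI2)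
qed

lemma pole_class_cover:
  assumes "d \<in> EP" "9 \<notin> d"
  shows "\<exists>k<3. d \<in> set ` set (pole_class k)"
proof -
  show ?thesis
    using assms unfolding edges_pole_P
    by (intro ex_less_3I) (elim insertE emptyE; simp add: pole_class_def doubleton_eq_iff)
qed

definition deleted :: "vertex set" where
  "deleted = (\<lambda>(i, h, p). pv i h p 9) ` ({1, 2, 3} \<times> {1, 2} \<times> {1, 2})"

lemma colour_class_cover:
  assumes e: "e \<in> edges graph_G" "e \<inter> deleted = {}"
  shows "\<exists>k<3. e \<in> set ` set (colour_class k)"
proof -
  have own: ?thesis if "i \<in> {1, 2, 3}" "xs \<in> set (own_part i)" "e = set xs" for i xs
  proof -
    \<comment> \<open>Classes are numbered from 0, which makes \<open>i - 1\<close> the colour of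
      the connecting edges of the \<open>i\<close>-th copy.\<close>
    have "xs \<in> set (colour_class (i - 1))" "i - 1 < 3"
      using that(1,2) by (elim insertE emptyE; simp add: colour_class_def)+
    then show ?thesis using that(3) by blast
  qed
  from e(1) show ?thesis
  proof (cases rule: edges_graph_G_cases)
    case triangle
    have "{Inl 2, Inl 3} \<in> set ` set (colour_class 0)"
      by (rule image_eqI[of _ _ "[Inl 2, Inl 3]"]) (simp_all add: colour_class_def)
    moreover have "{Inl 1, Inl 3} \<in> set ` set (colour_class 1)"
      by (rule image_eqI[of _ _ "[Inl 1, Inl 3]"]) (simp_all add: colour_class_def)
    moreover have "{Inl 1, Inl 2} \<in> set ` set (colour_class 2)"
      by (rule image_eqI[of _ _ "[Inl 1, Inl 2]"]) (simp_all add: colour_class_def)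
    moreover have "(0 :: nat) < 3" "(1 :: nat) < 3" "(2 :: nat) < 3" by simp_all
    moreover from triangle have "e = {Inl 1, Inl 2} \<or> e = {Inl 1, Inl 3} \<or> e = {Inl 2, Inl 3}"
      by (simp only: insert_iff empty_iff simp_thms)
    ultimately show ?thesis by metis
  next
    case (bottom i)
    show ?thesis
      by (rule own[OF bottom(1), of "[Inl 0, pv i 1 1 11]"]) (simp_all add: own_part_def bottom(2))
  next
    case (top i)
    show ?thesis
      by (rule own[OF top(1), of "[Inl i, pv i 2 1 12]"]) (simp_all add: own_part_def top(2))
  next
    case (middle i)
    show ?thesis
      by (rule own[OF middle(1), of "[pv i 1 1 12, pv i 2 1 11]"]) (simp_all add: own_part_def middle(2))
  next
    case (pole i h p d)
    have "9 \<notin> d"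
    proof
      assume "9 \<in> d"
      then have "emb i h p 9 \<in> e" using pole(5) by blast
      moreover have "emb i h p 9 \<in> deleted"
        using pole(1-3) unfolding emb_def deleted_def by (intro image_eqI[of _ _ "(i, h, p)"]) auto
      ultimately show False using e(2) by blast
    qed
    then obtain k where k: "k < 3" "d \<in> set ` set (pole_class k)"
      using pole_class_cover[OF pole(4)] by blast
    then have "e \<in> set ` set (part i h p k)"
      unfolding pole(5) part_def by (auto simp: image_iff)
    then show ?thesis
      using part_colour_class[OF pole(1-3) k(1)] by blast
  qed
qed

lemma resistance_upper:
  "\<exists>S. S \<subseteq> verts graph_G \<and> card S = 12 \<and> (\<exists>c. proper_edge_colouring 3 c (delete_verts S graph_G))"
proof -
  have sub: "deleted \<subseteq> verts graph_G"
    by (auto simp: deleted_def verts_graph_G)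
  have "inj_on (\<lambda>(i, h, p). pv i h p 9) J" for J
    by (auto simp: inj_on_def)
  then have card: "card deleted = 12"
    unfolding deleted_def by (subst card_image) simp_all
  \<comment> \<open>The colour of a surviving edge is the index of some class containing it; any
    such choice is proper because the classes are matchings.\<close>
  obtain c where c: "c e < 3 \<and> e \<in> set ` set (colour_class (c e))"
    if "e \<in> edges graph_G" "e \<inter> deleted = {}" for e
    using colour_class_cover by metis
  have "proper_edge_colouring 3 c (delete_verts deleted graph_G)"
    unfolding proper_edge_colouring_def
  proof (intro conjI ballI impI notI)
    fix e assume "e \<in> edges (delete_verts deleted graph_G)"
    then have e: "e \<in> edges graph_G" "e \<inter> deleted = {}" by (auto simp: delete_verts_def)
    then show "c e < 3" using c by blast
    fix f assume "f \<in> edges (delete_verts deleted graph_G)"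
    then have f: "f \<in> edges graph_G" "f \<inter> deleted = {}" by (auto simp: delete_verts_def)
    assume "e \<noteq> f \<and> e \<inter> f \<noteq> {}" "c e = c f"
    then show False
      using c[OF e] c[OF f] colour_class_matching[of "c e" e f] by simp
  qed
  with sub card show ?thesis by blast
qed

theorem theorem3:
  shows "resistance graph_G = 12 \<and> weak_oddness graph_G = 14 \<and> oddness graph_G = 16"
proof (intro conjI)
  show "resistance graph_G = 12"
    unfolding resistance_def
    using resistance_upper resistance_lower by (intro Least_equality) blast+
  show "weak_oddness graph_G = 14"
    unfolding weak_oddness_def
  proof (rule Least_equality)
    show "\<exists>F. even_factor F graph_G \<and> card (odd_components F) = 14"
      using weak_oddness_upper weak_oddness_lower by (meson le_antisym)
  qed (use weak_oddness_lower in blast)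
  show "oddness graph_G = 16"
    unfolding oddness_def
  proof (rule Least_equality)
    show "\<exists>F. two_factor F graph_G \<and> card (odd_components F) = 16"
      using oddness_upper oddness_lower by (meson le_antisym)
  qed (use oddness_lower in blast)
qed

end
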